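(* Let $(\mathcal{M},\otimes,\mathbf{1},c)$ be a braided monoidal category. Assume that $\mathcal{M}$ has denumerable coproducts and that the tensor functors $M\otimes(-)$ and $(-)\otimes M$ preserve such coproducts for every object $M$ in $\mathcal{M}$. Then $$J_{\mathrm{Alg}}\circ T=T_{\mathrm{Br}}\circ J:\mathcal{M}\to\mathrm{BrAlg}_{\mathcal{M}}.$$
   Context: Associativity constraints of $\mathcal M$ are suppressed; $l_X:\mathbf 1\otimes X\to X$, $r_X:X\otimes\mathbf 1\to X$; an object also denotes its identity morphism. $c_{U,V}:U\otimes V\to V\otimes U$ is the braiding of $\mathcal M$. $V^{\otimes 0}=\mathbf 1$, $V^{\otimes 1}=V$, $V^{\otimes n}=V^{\otimes(n-1)}\otimes V$ for $n\ge 2$. A braided object is a pair $(V,c_V)$ with $c_V:V\otimes V\to V\otimes V$ invertible and $(c_V\otimes V)(V\otimes c_V)(c_V\otimes V)=(V\otimes c_V)(c_V\otimes V)(V\otimes c_V)$; a morphism $(V,c_V)\to(W,c_W)$ is $f:V\to W$ with $c_W(f\otimes f)=(f\otimes f)c_V$; category $\mathrm{Br}_{\mathcal M}$. A braided algebra is $(A,m,u,c_A)$ with $(A,m,u)$ an algebra in $\mathcal M$, $(A,c_A)$ a braided object, and $c_A(m\otimes A)=(A\otimes m)(c_A\otimes A)(A\otimes c_A)$, $c_A(A\otimes m)=(m\otimes A)(A\otimes c_A)(c_A\otimes A)$, $c_A(u\otimes A)l_A^{-1}=(A\otimes u)r_A^{-1}$, $c_A(A\otimes u)r_A^{-1}=(u\otimes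 A)l_A^{-1}$; morphisms are algebra morphisms that are morphisms of braided objects; category $\mathrm{BrAlg}_{\mathcal M}$. $J:\mathcal M\to\mathrm{Br}_{\mathcal M}$, $JV=(V,c_{V,V})$, and $J_{\mathrm{Alg}}:\mathrm{Alg}_{\mathcal M}\to\mathrm{BrAlg}_{\mathcal M}$, $J_{\mathrm{Alg}}(A,m_A,u_A)=(A,m_A,u_A,c_{A,A})$, both acting as the identity on morphisms ($\mathrm{Alg}_{\mathcal M}$ = algebras in $\mathcal M$). $T:\mathcal M\to\mathrm{Alg}_{\mathcal M}$ is the tensor algebra functor, left adjoint to the forgetful functor $\Omega$: $\Omega TV=\oplus_{n\in\mathbb N}V^{\otimes n}$ with injections $\alpha_nV:V^{\otimes n}\to\Omega TV$; $\Omega Tf\circ\alpha_nV=\alpha_nW\circ f^{\otimes n}$; $m_{\Omega TV}\circ(\alpha_mV\otimes\alpha_nV)=\alpha_{m+n}V$; $u_{\Omega TV}=\alpha_0V$. $T_{\mathrm{Br}}:\mathrm{Br}_{\mathcal M}\to\mathrm{BrAlg}_{\mathcal M}$ is the left adjoint of the forgetful functor, given by $T_{\mathrm{Br}}(V,c_V)=(TV,c_T)$ where $c_T$ is uniquely determined by $c_T\circ(\alpha_mV\otimes\alpha_nV)=(\alpha_nV\otimes\alpha_mV)\circ c_T^{m,n}$, and $T_{\mathrm{Br}}(f)=T(f)$. Here $c_T^{a,b}:V^{\otimes a}\otimes V^{\otimes b}\to V^{\otimes b}\otimes V^{\otimes a}$ is the unique family such that for all $l,m,n\in\mathbb N$ (identifying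 $V^{\otimes l}\otimes V^{\otimes m}$ with $V^{\otimes(l+m)}$ via the constraints): $(V^{\otimes n}\otimes c_T^{l,m})(c_T^{l,n}\otimes V^{\otimes m})(V^{\otimes l}\otimes c_T^{m,n})=(c_T^{m,n}\otimes V^{\otimes l})(V^{\otimes m}\otimes c_T^{l,n})(c_T^{l,m}\otimes V^{\otimes n})$; $(c_T^{l,n}\otimes V^{\otimes m})(V^{\otimes l}\otimes c_T^{m,n})=c_T^{l+m,n}$ for $l,m\ne0$; $(V^{\otimes m}\otimes c_T^{l,n})(c_T^{l,m}\otimes V^{\otimes n})=c_T^{l,m+n}$ for $m,n\ne0$; $c_T^{0,n}l_{V^{\otimes n}}^{-1}=r_{V^{\otimes n}}^{-1}$; $c_T^{n,0}r_{V^{\otimes n}}^{-1}=l_{V^{\otimes n}}^{-1}$; $c_T^{1,1}=c_V$. *)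

theory Defs
  imports "HOL-Library.FuncSet"
begin

section \<open>Categories and functors\<close>

record ('o, 'm) cat =
  Ob :: "'o set"
  Ar :: "'m set"
  Dom :: "'m \<Rightarrow> 'o"
  Cod :: "'m \<Rightarrow> 'o"
  Ident :: "'o \<Rightarrow> 'm"  (\<open>\<iota>\<index>\<close>)
  Cmp :: "'m \<Rightarrow> 'm \<Rightarrow> 'm"  (infixr \<open>\<cdot>\<index>\<close> 55)

definition Hom :: "('o, 'm, 'z) cat_scheme \<Rightarrow> 'o \<Rightarrow> 'o \<Rightarrow> 'm set"
  where "Hom C X Y = {f \<in> Ar C. Dom C f = X \<and> Cod C f = Y}"

locale category =
  fixes C :: "('o, 'm, 'z) cat_scheme" (structure)
  assumes dom_ob: "f \<in> Ar C \<Longrightarrow> Dom C f \<in> Ob C"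
    and cod_ob: "f \<in> Ar C \<Longrightarrow> Cod C f \<in> Ob C"
    and ident_hom: "X \<in> Ob C \<Longrightarrow> \<iota> X \<in> Hom C X X"
    and cmp_hom: "\<lbrakk>f \<in> Hom C X Y; g \<in> Hom C Y Z\<rbrakk> \<Longrightarrow> g \<cdot> f \<in> Hom C X Z"
    and cmp_ident_right: "f \<in> Hom C X Y \<Longrightarrow> f \<cdot> \<iota> X = f"
    and cmp_ident_left: "f \<in> Hom C X Y \<Longrightarrow> \<iota> Y \<cdot> f = f"
    and cmp_assoc:
      "\<lbrakk>f \<in> Hom C W X; g \<in> Hom C X Y; h \<in> Hom C Y Z\<rbrakk> \<Longrightarrow> (h \<cdot> g) \<cdot> f = h \<cdot> (g \<cdot> f)"

definition inverse_arrows :: "('o, 'm, 'z) cat_scheme \<Rightarrow> 'm \<Rightarrow> 'm \<Rightarrow> bool"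
  where "inverse_arrows C f g \<longleftrightarrow>
    f \<in> Ar C \<and> g \<in> Hom C (Cod C f) (Dom C f) \<and>
    g \<cdot>\<^bsub>C\<^esub> f = \<iota>\<^bsub>C\<^esub> (Dom C f) \<and> f \<cdot>\<^bsub>C\<^esub> g = \<iota>\<^bsub>C\<^esub> (Cod C f)"

definition iso :: "('o, 'm, 'z) cat_scheme \<Rightarrow> 'm \<Rightarrow> bool"
  where "iso C f \<longleftrightarrow> (\<exists>g. inverse_arrows C f g)"

definition inv_ar :: "('o, 'm, 'z) cat_scheme \<Rightarrow> 'm \<Rightarrow> 'm"  (\<open>inv\<index> _\<close> [81] 80)
  where "inv\<^bsub>C\<^esub> f = (THE g. inverse_arrows C f g)"

text \<open>The maps of a functor are required to be undefined off the objects and arrows of its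
  source, so that equality of functors is equality of records.\<close>

record ('o, 'm, 'p, 'n) cat_map =
  OnOb :: "'o \<Rightarrow> 'p"
  OnAr :: "'m \<Rightarrow> 'n"

locale cat_functor = C: category C + D: category D
  for C :: "('o, 'm, 'y) cat_scheme" and D :: "('p, 'n, 'z) cat_scheme" +
  fixes F :: "('o, 'm, 'p, 'n) cat_map"
  assumes onOb: "OnOb F \<in> Ob C \<rightarrow>\<^sub>E Ob D"
    and onAr: "OnAr F \<in> Ar C \<rightarrow>\<^sub>E Ar D"
    and onAr_hom: "f \<in> Hom C X Y \<Longrightarrow> OnAr F f \<in> Hom D (OnOb F X) (OnOb F Y)"
    and onAr_ident: "X \<in> Ob C \<Longrightarrow> OnAr F (\<iota>\<^bsub>C\<^esub> X) = \<iota>\<^bsub>D\<^esub> (OnOb F X)"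
    and onAr_cmp: "\<lbrakk>f \<in> Hom C X Y; g \<in> Hom C Y Z\<rbrakk> \<Longrightarrow>
      OnAr F (g \<cdot>\<^bsub>C\<^esub> f) = OnAr F g \<cdot>\<^bsub>D\<^esub> OnAr F f"

text \<open>\<open>G \<circ>\<^bsub>C\<^esub> F\<close> is the composite of \<open>F\<close> and \<open>G\<close>, where \<open>C\<close> is the source of \<open>F\<close>.\<close>

definition cat_map_comp ::
    "('p, 'n, 'q, 'k) cat_map \<Rightarrow> ('o, 'm, 'z) cat_scheme \<Rightarrow> ('o, 'm, 'p, 'n) cat_map
      \<Rightarrow> ('o, 'm, 'q, 'k) cat_map"  (\<open>_ \<circ>\<^bsub>_\<^esub> _\<close> [56, 0, 55] 55)
  where "G \<circ>\<^bsub>C\<^esub> F =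
    \<lparr>OnOb = compose (Ob C) (OnOb G) (OnOb F), OnAr = compose (Ar C) (OnAr G) (OnAr F)\<rparr>"

text \<open>The category of objects of \<open>C\<close> with extra structure: \<open>U X\<close> is the object underlying
  \<open>X \<in> S\<close>, and \<open>P X f Y\<close> says that \<open>f\<close> respects the structures. An arrow carries its source
  and target, since \<open>f\<close> alone does not determine the structures.\<close>

definition structure_cat ::
    "('o, 'm, 'z) cat_scheme \<Rightarrow> 's set \<Rightarrow> ('s \<Rightarrow> 'o) \<Rightarrow> ('s \<Rightarrow> 'm \<Rightarrow> 's \<Rightarrow> bool)
      \<Rightarrow> ('s, 's \<times> 'm \<times> 's) cat"
  where "structure_cat C S U P =
    \<lparr>Ob = S,
     Ar = {(X, f, Y). X \<in> S \<and> Y \<in> S \<and> f \<in> Hom C (U X) (U Y) \<and> P X f Y},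
     Dom = (\<lambda>(X, f, Y). X),
     Cod = (\<lambda>(X, f, Y). Y),
     Ident = (\<lambda>X. (X, \<iota>\<^bsub>C\<^esub> (U X), X)),
     Cmp = (\<lambda>(Y', g, Z) (X, f, Y). (X, g \<cdot>\<^bsub>C\<^esub> f, Z))\<rparr>"

definition is_coproduct ::
    "('o, 'm, 'z) cat_scheme \<Rightarrow> (nat \<Rightarrow> 'o) \<Rightarrow> 'o \<Rightarrow> (nat \<Rightarrow> 'm) \<Rightarrow> bool"
  where "is_coproduct C F X i \<longleftrightarrow>
    X \<in> Ob C \<and> (\<forall>n. F n \<in> Ob C) \<and> (\<forall>n. i n \<in> Hom C (F n) X) \<and>
    (\<forall>Y g. Y \<in> Ob C \<and> (\<forall>n. g n \<in> Hom C (F n) Y) \<longrightarrow>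
      (\<exists>!h. h \<in> Hom C X Y \<and> (\<forall>n. h \<cdot>\<^bsub>C\<^esub> i n = g n)))"

definition has_denumerable_coproducts :: "('o, 'm, 'z) cat_scheme \<Rightarrow> bool"
  where "has_denumerable_coproducts C \<longleftrightarrow>
    (\<forall>F. (\<forall>n. F n \<in> Ob C) \<longrightarrow> (\<exists>X i. is_coproduct C F X i))"


section \<open>Braided monoidal categories\<close>

text \<open>\<open>\<otimes>\<close> is the tensor product of objects and \<open>\<boxtimes>\<close> that of arrows.\<close>

record ('o, 'm) braided = "('o, 'm) cat" +
  TensorOb :: "'o \<Rightarrow> 'o \<Rightarrow> 'o"  (infixl \<open>\<otimes>\<index>\<close> 70)
  TensorAr :: "'m \<Rightarrow> 'm \<Rightarrow> 'm"  (infixl \<open>\<boxtimes>\<index>\<close> 70)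
  UnitOb :: "'o"  (\<open>\<one>\<index>\<close>)
  Assoc :: "'o \<Rightarrow> 'o \<Rightarrow> 'o \<Rightarrow> 'm"  (\<open>\<a>\<index>\<close>)
  LUnit :: "'o \<Rightarrow> 'm"  (\<open>\<l>\<index>\<close>)
  RUnit :: "'o \<Rightarrow> 'm"  (\<open>\<r>\<index>\<close>)
  Braid :: "'o \<Rightarrow> 'o \<Rightarrow> 'm"  (\<open>\<c>\<index>\<close>)

locale braided_monoidal_category = category M
  for M :: "('o, 'm) braided" (structure) +
  assumes tensor_ob: "\<lbrakk>X \<in> Ob M; Y \<in> Ob M\<rbrakk> \<Longrightarrow> X \<otimes> Y \<in> Ob M"
    and tensor_hom: "\<lbrakk>f \<in> Hom M X X'; g \<in> Hom M Y Y'\<rbrakk> \<Longrightarrow> f \<boxtimes> g \<in> Hom M (X \<otimes> Y) (X' \<otimes> Y')"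
    and tensor_ident: "\<lbrakk>X \<in> Ob M; Y \<in> Ob M\<rbrakk> \<Longrightarrow> \<iota> X \<boxtimes> \<iota> Y = \<iota> (X \<otimes> Y)"
    and tensor_cmp:
      "\<lbrakk>f \<in> Hom M X X'; f' \<in> Hom M X' X''; g \<in> Hom M Y Y'; g' \<in> Hom M Y' Y''\<rbrakk> \<Longrightarrow>
        (f' \<cdot> f) \<boxtimes> (g' \<cdot> g) = (f' \<boxtimes> g') \<cdot> (f \<boxtimes> g)"
    and unit_ob: "\<one> \<in> Ob M"
    and assoc_hom: "\<lbrakk>X \<in> Ob M; Y \<in> Ob M; Z \<in> Ob M\<rbrakk> \<Longrightarrow>
        \<a> X Y Z \<in> Hom M ((X \<otimes> Y) \<otimes> Z) (X \<otimes> (Y \<otimes> Z))"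
    and assoc_iso: "\<lbrakk>X \<in> Ob M; Y \<in> Ob M; Z \<in> Ob M\<rbrakk> \<Longrightarrow> iso M (\<a> X Y Z)"
    and assoc_nat: "\<lbrakk>f \<in> Hom M X X'; g \<in> Hom M Y Y'; h \<in> Hom M Z Z'\<rbrakk> \<Longrightarrow>
        \<a> X' Y' Z' \<cdot> ((f \<boxtimes> g) \<boxtimes> h) = (f \<boxtimes> (g \<boxtimes> h)) \<cdot> \<a> X Y Z"
    and lunit_hom: "X \<in> Ob M \<Longrightarrow> \<l> X \<in> Hom M (\<one> \<otimes> X) X"
    and lunit_iso: "X \<in> Ob M \<Longrightarrow> iso M (\<l> X)"
    and lunit_nat: "f \<in> Hom M X Y \<Longrightarrow> \<l> Y \<cdot> (\<iota> \<one> \<boxtimes> f) = f \<cdot> \<l> X"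
    and runit_hom: "X \<in> Ob M \<Longrightarrow> \<r> X \<in> Hom M (X \<otimes> \<one>) X"
    and runit_iso: "X \<in> Ob M \<Longrightarrow> iso M (\<r> X)"
    and runit_nat: "f \<in> Hom M X Y \<Longrightarrow> \<r> Y \<cdot> (f \<boxtimes> \<iota> \<one>) = f \<cdot> \<r> X"
    and pentagon: "\<lbrakk>W \<in> Ob M; X \<in> Ob M; Y \<in> Ob M; Z \<in> Ob M\<rbrakk> \<Longrightarrow>
        \<a> W X (Y \<otimes> Z) \<cdot> \<a> (W \<otimes> X) Y Z =
        (\<iota> W \<boxtimes> \<a> X Y Z) \<cdot> \<a> W (X \<otimes> Y) Z \<cdot> (\<a> W X Y \<boxtimes> \<iota> Z)"
    and triangle: "\<lbrakk>X \<in> Ob M; Y \<in> Ob M\<rbrakk> \<Longrightarrow> (\<iota> X \<boxtimes> \<l> Y) \<cdot> \<a> X \<one> Y = \<r> X \<boxtimes> \<iota> Y"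
    and braid_hom: "\<lbrakk>X \<in> Ob M; Y \<in> Ob M\<rbrakk> \<Longrightarrow> \<c> X Y \<in> Hom M (X \<otimes> Y) (Y \<otimes> X)"
    and braid_iso: "\<lbrakk>X \<in> Ob M; Y \<in> Ob M\<rbrakk> \<Longrightarrow> iso M (\<c> X Y)"
    and braid_nat: "\<lbrakk>f \<in> Hom M X X'; g \<in> Hom M Y Y'\<rbrakk> \<Longrightarrow>
        \<c> X' Y' \<cdot> (f \<boxtimes> g) = (g \<boxtimes> f) \<cdot> \<c> X Y"
    and hexagon1: "\<lbrakk>X \<in> Ob M; Y \<in> Ob M; Z \<in> Ob M\<rbrakk> \<Longrightarrow>
        \<a> Y Z X \<cdot> \<c> X (Y \<otimes> Z) \<cdot> \<a> X Y Z =
        (\<iota> Y \<boxtimes> \<c> X Z) \<cdot> \<a> Y X Z \<cdot> (\<c> X Y \<boxtimes> \<iota> Z)"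
    and hexagon2: "\<lbrakk>X \<in> Ob M; Y \<in> Ob M; Z \<in> Ob M\<rbrakk> \<Longrightarrow>
        inv (\<a> Z X Y) \<cdot> \<c> (X \<otimes> Y) Z \<cdot> inv (\<a> X Y Z) =
        (\<c> X Z \<boxtimes> \<iota> Y) \<cdot> inv (\<a> X Z Y) \<cdot> (\<iota> X \<boxtimes> \<c> Y Z)"

context
  fixes M :: "('o, 'm) braided" (structure)
begin

definition tensor_preserves_denumerable_coproducts :: bool
  where "tensor_preserves_denumerable_coproducts \<longleftrightarrow>
    (\<forall>X \<in> Ob M. \<forall>F Y i. is_coproduct M F Y i \<longrightarrow>
      is_coproduct M (\<lambda>n. X \<otimes> F n) (X \<otimes> Y) (\<lambda>n. \<iota> X \<boxtimes> i n) \<and>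
      is_coproduct M (\<lambda>n. F n \<otimes> X) (Y \<otimes> X) (\<lambda>n. i n \<boxtimes> \<iota> X))"

text \<open>For \<open>f : Y \<otimes> Z \<rightarrow> Z \<otimes> Y\<close>, this is the arrow \<open>(X \<otimes> Y) \<otimes> Z \<rightarrow> (X \<otimes> Z) \<otimes> Y\<close> written
  \<open>X \<otimes> f\<close> when associativity constraints are suppressed.\<close>

definition lwhisk :: "'o \<Rightarrow> 'o \<Rightarrow> 'o \<Rightarrow> 'm \<Rightarrow> 'm"
  where "lwhisk X Y Z f = inv (\<a> X Z Y) \<cdot> (\<iota> X \<boxtimes> f) \<cdot> \<a> X Y Z"


section \<open>Braided objects, algebras and braided algebras\<close>

fun braided_object :: "'o \<times> 'm \<Rightarrow> bool"
  where "braided_object (V, c) \<longleftrightarrow>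
    V \<in> Ob M \<and> c \<in> Hom M (V \<otimes> V) (V \<otimes> V) \<and> iso M c \<and>
    (c \<boxtimes> \<iota> V) \<cdot> lwhisk V V V c \<cdot> (c \<boxtimes> \<iota> V) =
    lwhisk V V V c \<cdot> (c \<boxtimes> \<iota> V) \<cdot> lwhisk V V V c"

fun braided_morphism :: "'o \<times> 'm \<Rightarrow> 'm \<Rightarrow> 'o \<times> 'm \<Rightarrow> bool"
  where "braided_morphism (V, c) f (W, d) \<longleftrightarrow> d \<cdot> (f \<boxtimes> f) = (f \<boxtimes> f) \<cdot> c"

definition Br :: "('o \<times> 'm, ('o \<times> 'm) \<times> 'm \<times> ('o \<times> 'm)) cat"
  where "Br = structure_cat M (Collect braided_object) fst braided_morphism"

fun algebra :: "'o \<times> 'm \<times> 'm \<Rightarrow> bool"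
  where "algebra (A, m, u) \<longleftrightarrow>
    A \<in> Ob M \<and> m \<in> Hom M (A \<otimes> A) A \<and> u \<in> Hom M \<one> A \<and>
    m \<cdot> (m \<boxtimes> \<iota> A) = m \<cdot> (\<iota> A \<boxtimes> m) \<cdot> \<a> A A A \<and>
    m \<cdot> (u \<boxtimes> \<iota> A) = \<l> A \<and>
    m \<cdot> (\<iota> A \<boxtimes> u) = \<r> A"

fun algebra_morphism :: "'o \<times> 'm \<times> 'm \<Rightarrow> 'm \<Rightarrow> 'o \<times> 'm \<times> 'm \<Rightarrow> bool"
  where "algebra_morphism (A, m, u) f (B, m', u') \<longleftrightarrow>
    f \<cdot> m = m' \<cdot> (f \<boxtimes> f) \<and> f \<cdot> u = u'"

definition Alg :: "('o \<times> 'm \<times> 'm, ('o \<times> 'm \<times> 'm) \<times> 'm \<times> ('o \<times> 'm \<times> 'm)) cat"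
  where "Alg = structure_cat M (Collect algebra) fst algebra_morphism"

text \<open>The first two compatibilities are written as equations between arrows with source
  \<open>(A \<otimes> A) \<otimes> A\<close>.\<close>

fun braided_algebra :: "'o \<times> 'm \<times> 'm \<times> 'm \<Rightarrow> bool"
  where "braided_algebra (A, m, u, c) \<longleftrightarrow>
    algebra (A, m, u) \<and> braided_object (A, c) \<and>
    c \<cdot> (m \<boxtimes> \<iota> A) = (\<iota> A \<boxtimes> m) \<cdot> \<a> A A A \<cdot> (c \<boxtimes> \<iota> A) \<cdot> lwhisk A A A c \<and>
    c \<cdot> (\<iota> A \<boxtimes> m) \<cdot> \<a> A A A = (m \<boxtimes> \<iota> A) \<cdot> lwhisk A A A c \<cdot> (c \<boxtimes> \<iota> A) \<and>
    c \<cdot> (u \<boxtimes> \<iota> A) \<cdot> inv (\<l> A) = (\<iota> A \<boxtimes> u) \<cdot> inv (\<r> A) \<and>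
    c \<cdot> (\<iota> A \<boxtimes> u) \<cdot> inv (\<r> A) = (u \<boxtimes> \<iota> A) \<cdot> inv (\<l> A)"

fun braided_algebra_morphism ::
    "'o \<times> 'm \<times> 'm \<times> 'm \<Rightarrow> 'm \<Rightarrow> 'o \<times> 'm \<times> 'm \<times> 'm \<Rightarrow> bool"
  where "braided_algebra_morphism (A, m, u, c) f (B, m', u', c') \<longleftrightarrow>
    algebra_morphism (A, m, u) f (B, m', u') \<and> braided_morphism (A, c) f (B, c')"

definition BrAlg ::
    "('o \<times> 'm \<times> 'm \<times> 'm, ('o \<times> 'm \<times> 'm \<times> 'm) \<times> 'm \<times> ('o \<times> 'm \<times> 'm \<times> 'm)) cat"
  where "BrAlg = structure_cat M (Collect braided_algebra) fst braided_algebra_morphism"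

definition J :: "('o, 'm, 'o \<times> 'm, ('o \<times> 'm) \<times> 'm \<times> ('o \<times> 'm)) cat_map"
  where "J =
    \<lparr>OnOb = (\<lambda>V \<in> Ob M. (V, \<c> V V)),
     OnAr = (\<lambda>f \<in> Ar M.
       ((Dom M f, \<c> (Dom M f) (Dom M f)), f, (Cod M f, \<c> (Cod M f) (Cod M f))))\<rparr>"

fun with_braiding :: "'o \<times> 'm \<times> 'm \<Rightarrow> 'o \<times> 'm \<times> 'm \<times> 'm"
  where "with_braiding (A, m, u) = (A, m, u, \<c> A A)"

definition J\<^sub>A\<^sub>l\<^sub>g ::
    "('o \<times> 'm \<times> 'm, ('o \<times> 'm \<times> 'm) \<times> 'm \<times> ('o \<times> 'm \<times> 'm),
      'o \<times> 'm \<times> 'm \<times> 'm, ('o \<times> 'm \<times> 'm \<times> 'm) \<times> 'm \<times> ('o \<times> 'm \<times> 'm \<times> 'm)) cat_map"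
  where "J\<^sub>A\<^sub>l\<^sub>g =
    \<lparr>OnOb = (\<lambda>A \<in> Ob Alg. with_braiding A),
     OnAr = (\<lambda>(A, f, B) \<in> Ar Alg. (with_braiding A, f, with_braiding B))\<rparr>"


section \<open>Tensor powers\<close>

fun tpow :: "'o \<Rightarrow> nat \<Rightarrow> 'o"
  where
    "tpow V 0 = \<one>"
  | "tpow V (Suc 0) = V"
  | "tpow V (Suc (Suc n)) = tpow V (Suc n) \<otimes> V"

fun tpow_ar :: "'m \<Rightarrow> nat \<Rightarrow> 'm"
  where
    "tpow_ar f 0 = \<iota> \<one>"
  | "tpow_ar f (Suc 0) = f"
  | "tpow_ar f (Suc (Suc n)) = tpow_ar f (Suc n) \<boxtimes> f"

text \<open>\<open>tmerge V m n : tpow V m \<otimes> tpow V n \<rightarrow> tpow V (m + n)\<close> is the canonical isomorphism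
  composed of constraints; it is the identification left implicit when they are suppressed.\<close>

fun tmerge :: "'o \<Rightarrow> nat \<Rightarrow> nat \<Rightarrow> 'm"
  where
    "tmerge V m 0 = \<r> (tpow V m)"
  | "tmerge V m (Suc 0) = (if m = 0 then \<l> V else \<iota> (tpow V m \<otimes> V))"
  | "tmerge V m (Suc (Suc n)) =
      (tmerge V m (Suc n) \<boxtimes> \<iota> V) \<cdot> inv (\<a> (tpow V m) (tpow V (Suc n)) V)"

text \<open>The defining conditions of the family \<open>c\<^sub>T\<^bsup>m,n\<^esup>\<close>, with all constraints inserted.\<close>

definition is_tpow_braiding :: "'o \<Rightarrow> 'm \<Rightarrow> (nat \<Rightarrow> nat \<Rightarrow> 'm) \<Rightarrow> bool"
  where "is_tpow_braiding V c\<^sub>V c \<longleftrightarrow>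
    (\<forall>m n. c m n \<in> Hom M (tpow V m \<otimes> tpow V n) (tpow V n \<otimes> tpow V m)) \<and>
    (\<forall>l m n.
      lwhisk (tpow V n) (tpow V l) (tpow V m) (c l m) \<cdot>
      (c l n \<boxtimes> \<iota> (tpow V m)) \<cdot>
      lwhisk (tpow V l) (tpow V m) (tpow V n) (c m n) =
      (c m n \<boxtimes> \<iota> (tpow V l)) \<cdot>
      lwhisk (tpow V m) (tpow V l) (tpow V n) (c l n) \<cdot>
      (c l m \<boxtimes> \<iota> (tpow V n))) \<and>
    (\<forall>l m n. l \<noteq> 0 \<and> m \<noteq> 0 \<longrightarrow>
      (\<iota> (tpow V n) \<boxtimes> tmerge V l m) \<cdot> \<a> (tpow V n) (tpow V l) (tpow V m) \<cdot>
      (c l n \<boxtimes> \<iota> (tpow V m)) \<cdot>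
      lwhisk (tpow V l) (tpow V m) (tpow V n) (c m n) =
      c (l + m) n \<cdot> (tmerge V l m \<boxtimes> \<iota> (tpow V n))) \<and>
    (\<forall>l m n. m \<noteq> 0 \<and> n \<noteq> 0 \<longrightarrow>
      (tmerge V m n \<boxtimes> \<iota> (tpow V l)) \<cdot>
      lwhisk (tpow V m) (tpow V l) (tpow V n) (c l n) \<cdot>
      (c l m \<boxtimes> \<iota> (tpow V n)) =
      c l (m + n) \<cdot> (\<iota> (tpow V l) \<boxtimes> tmerge V m n) \<cdot>
      \<a> (tpow V l) (tpow V m) (tpow V n)) \<and>
    (\<forall>n. c 0 n \<cdot> inv (\<l> (tpow V n)) = inv (\<r> (tpow V n))) \<and>
    (\<forall>n. c n 0 \<cdot> inv (\<r> (tpow V n)) = inv (\<l> (tpow V n))) \<and>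
    c 1 1 = c\<^sub>V"

definition tpow_braiding :: "'o \<Rightarrow> 'm \<Rightarrow> nat \<Rightarrow> nat \<Rightarrow> 'm"
  where "tpow_braiding V c\<^sub>V = (THE c. is_tpow_braiding V c\<^sub>V c)"

end


section \<open>The tensor algebra functors\<close>

text \<open>Coproducts are determined only up to isomorphism, so the functors depend on a choice, for
  every \<open>V\<close>, of a coproduct \<open>S V\<close> of the tensor powers of \<open>V\<close> with injections \<open>\<alpha> V n\<close>.\<close>

context
  fixes M :: "('o, 'm) braided" (structure)
    and S :: "'o \<Rightarrow> 'o"
    and \<alpha> :: "'o \<Rightarrow> nat \<Rightarrow> 'm"
begin

definition T_mult :: "'o \<Rightarrow> 'm"
  where "T_mult V = (THE \<mu>. \<mu> \<in> Hom M (S V \<otimes> S V) (S V) \<and>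
    (\<forall>m n. \<mu> \<cdot> (\<alpha> V m \<boxtimes> \<alpha> V n) = \<alpha> V (m + n) \<cdot> tmerge M V m n))"

definition T_ob :: "'o \<Rightarrow> 'o \<times> 'm \<times> 'm"
  where "T_ob V = (S V, T_mult V, \<alpha> V 0)"

definition T_ar :: "'m \<Rightarrow> 'm"
  where "T_ar f = (THE g. g \<in> Hom M (S (Dom M f)) (S (Cod M f)) \<and>
    (\<forall>n. g \<cdot> \<alpha> (Dom M f) n = \<alpha> (Cod M f) n \<cdot> tpow_ar M f n))"

definition T :: "('o, 'm, 'o \<times> 'm \<times> 'm, ('o \<times> 'm \<times> 'm) \<times> 'm \<times> ('o \<times> 'm \<times> 'm)) cat_map"
  where "T =
    \<lparr>OnOb = (\<lambda>V \<in> Ob M. T_ob V),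
     OnAr = (\<lambda>f \<in> Ar M. (T_ob (Dom M f), T_ar f, T_ob (Cod M f)))\<rparr>"

definition T_braiding :: "'o \<Rightarrow> 'm \<Rightarrow> 'm"
  where "T_braiding V c\<^sub>V = (THE c. c \<in> Hom M (S V \<otimes> S V) (S V \<otimes> S V) \<and>
    (\<forall>m n. c \<cdot> (\<alpha> V m \<boxtimes> \<alpha> V n) = (\<alpha> V n \<boxtimes> \<alpha> V m) \<cdot> tpow_braiding M V c\<^sub>V m n))"

fun T\<^sub>B\<^sub>r_ob :: "'o \<times> 'm \<Rightarrow> 'o \<times> 'm \<times> 'm \<times> 'm"
  where "T\<^sub>B\<^sub>r_ob (V, c\<^sub>V) = (S V, T_mult V, \<alpha> V 0, T_braiding V c\<^sub>V)"

definition T\<^sub>B\<^sub>r ::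
    "('o \<times> 'm, ('o \<times> 'm) \<times> 'm \<times> ('o \<times> 'm),
      'o \<times> 'm \<times> 'm \<times> 'm, ('o \<times> 'm \<times> 'm \<times> 'm) \<times> 'm \<times> ('o \<times> 'm \<times> 'm \<times> 'm)) cat_map"
  where "T\<^sub>B\<^sub>r =
    \<lparr>OnOb = (\<lambda>X \<in> Ob (Br M). T\<^sub>B\<^sub>r_ob X),
     OnAr = (\<lambda>(X, f, Y) \<in> Ar (Br M). (T\<^sub>B\<^sub>r_ob X, T_ar f, T\<^sub>B\<^sub>r_ob Y))\<rparr>"

end

end

theory Submission
  imports Defs
begin

text \<open>On a braided object of the form \<open>(V, \<c> V V)\<close>, the family of braidings
  \<open>\<c> (tpow V m) (tpow V n)\<close> satisfies the defining conditions of \<open>c\<^sub>T\<^bsup>m,n\<^esup>\<close>: these are the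
  hexagons combined with naturality, and the compatibility of a braiding with the unit. By induction
  the conditions have only one solution. Naturality of the braiding along the injections \<open>\<alpha> V n\<close>
  then identifies \<open>c\<^sub>T\<close> with \<open>\<c> (S V) (S V)\<close>, because the arrows \<open>\<alpha> V m \<boxtimes> \<alpha> V n\<close> are jointly
  epic when the tensor functors preserve the coproducts. What remains is the coherence of the
  identifications \<open>tpow V m \<otimes> tpow V n \<cong> tpow V (m + n)\<close>, which makes \<open>S V\<close> an algebra.\<close>


section \<open>Arrows of a category\<close>

lemma Hom_iff: "f \<in> Hom C X Y \<longleftrightarrow> f \<in> Ar C \<and> Dom C f = X \<and> Cod C f = Y"
  by (simp add: Hom_def)

context category
begin

text \<open>Membership in \<open>Hom\<close> is split into conditions on \<open>Ar\<close>,
  \<open>Dom\<close> and \<open>Cod\<close>, so that the simplifier can discharge the typing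
  conditions of its rules by computing domains and codomains.\<close>

lemma ident_ar [simp]: "X \<in> Ob C \<Longrightarrow> \<iota> X \<in> Ar C"
  and dom_ident [simp]: "X \<in> Ob C \<Longrightarrow> Dom C (\<iota> X) = X"
  and cod_ident [simp]: "X \<in> Ob C \<Longrightarrow> Cod C (\<iota> X) = X"
  using ident_hom by (auto simp: Hom_iff)

lemma cmp_ar [simp]: "\<lbrakk>f \<in> Ar C; g \<in> Ar C; Dom C g = Cod C f\<rbrakk> \<Longrightarrow> g \<cdot> f \<in> Ar C"
  and dom_cmp [simp]: "\<lbrakk>f \<in> Ar C; g \<in> Ar C; Dom C g = Cod C f\<rbrakk> \<Longrightarrow> Dom C (g \<cdot> f) = Dom C f"
  and cod_cmp [simp]: "\<lbrakk>f \<in> Ar C; g \<in> Ar C; Dom C g = Cod C f\<rbrakk> \<Longrightarrow> Cod C (g \<cdot> f) = Cod C g"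
  using cmp_hom[of f "Dom C f" "Cod C f" g "Cod C g"] by (auto simp: Hom_iff)

lemma ident_cmp [simp]: "\<lbrakk>f \<in> Ar C; Cod C f = Y\<rbrakk> \<Longrightarrow> \<iota> Y \<cdot> f = f"
  and cmp_ident [simp]: "\<lbrakk>f \<in> Ar C; Dom C f = X\<rbrakk> \<Longrightarrow> f \<cdot> \<iota> X = f"
  using cmp_ident_left cmp_ident_right by (auto simp: Hom_iff)

text \<open>Orients composites to the right; the cancellation and naturality rules below are stated
  for this normal form.\<close>

lemma assoc_cmp [simp]:
  "\<lbrakk>f \<in> Ar C; g \<in> Ar C; h \<in> Ar C; Dom C g = Cod C f; Dom C h = Cod C g\<rbrakk>
    \<Longrightarrow> (h \<cdot> g) \<cdot> f = h \<cdot> (g \<cdot> f)"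
  using cmp_assoc by (auto simp: Hom_iff)

declare dom_ob [simp] cod_ob [simp]

section \<open>Inverses and isomorphisms\<close>

lemma inverse_arrows_unique:
  assumes "inverse_arrows C f g" and "inverse_arrows C f g'"
  shows "g = g'"
proof -
  have "g = g \<cdot> (f \<cdot> g')"
    using assms by (auto simp: inverse_arrows_def Hom_iff)
  also have "\<dots> = (g \<cdot> f) \<cdot> g'"
    using assms by (subst assoc_cmp) (auto simp: inverse_arrows_def Hom_iff)
  also have "\<dots> = g'"
    using assms by (auto simp: inverse_arrows_def Hom_iff)
  finally show ?thesis .
qed

lemma inv_ar_eq: "inverse_arrows C f g \<Longrightarrow> inv f = g"
  unfolding inv_ar_def using inverse_arrows_unique by blast

lemma inverse_arrows_inv: "iso C f \<Longrightarrow> inverse_arrows C f (inv f)"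
  using inv_ar_eq by (auto simp: iso_def)

lemma iso_ar: "iso C f \<Longrightarrow> f \<in> Ar C"
  by (auto simp: iso_def inverse_arrows_def)

lemma inv_ar [simp]: "iso C f \<Longrightarrow> inv f \<in> Ar C"
  and dom_inv [simp]: "iso C f \<Longrightarrow> Dom C (inv f) = Cod C f"
  and cod_inv [simp]: "iso C f \<Longrightarrow> Cod C (inv f) = Dom C f"
  and inv_cmp [simp]: "iso C f \<Longrightarrow> inv f \<cdot> f = \<iota> (Dom C f)"
  and cmp_inv [simp]: "iso C f \<Longrightarrow> f \<cdot> inv f = \<iota> (Cod C f)"
  using inverse_arrows_inv by (auto simp: inverse_arrows_def Hom_iff)

text \<open>In a composite associated to the right, \<open>f\<close> is hidden behind its own tail;
  this form lets \<open>inv f\<close> cancel it there.\<close>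

lemma inv_cmp_cmp [simp]:
  assumes "iso C f" "h \<in> Ar C" "Cod C h = Dom C f"
  shows "inv f \<cdot> (f \<cdot> h) = h"
  using assms iso_ar[of f] by (subst assoc_cmp[symmetric]) auto

lemma cmp_inv_cmp [simp]:
  assumes "iso C f" "h \<in> Ar C" "Cod C h = Cod C f"
  shows "f \<cdot> (inv f \<cdot> h) = h"
  using assms iso_ar[of f] by (subst assoc_cmp[symmetric]) auto

lemma isoI:
  "\<lbrakk>f \<in> Ar C; g \<in> Ar C; Dom C g = Cod C f; Cod C g = Dom C f;
    g \<cdot> f = \<iota> (Dom C f); f \<cdot> g = \<iota> (Cod C f)\<rbrakk> \<Longrightarrow> iso C f"
  by (auto simp: iso_def inverse_arrows_def Hom_iff)

lemma iso_ident [simp]: "X \<in> Ob C \<Longrightarrow> iso C (\<iota> X)"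
  by (rule isoI[of _ "\<iota> X"]) auto

lemma iso_inv [simp]: "iso C f \<Longrightarrow> iso C (inv f)"
  by (rule isoI[of _ f]) (auto simp: iso_ar)

lemma iso_cmp [simp]: "\<lbrakk>iso C f; iso C g; Dom C g = Cod C f\<rbrakk> \<Longrightarrow> iso C (g \<cdot> f)"
  by (rule isoI[of _ "inv f \<cdot> inv g"]) (auto simp: iso_ar)

lemma cmp_iso_cancel:
  assumes "f \<cdot> k = g \<cdot> k" "iso C k" "f \<in> Ar C" "g \<in> Ar C" "Dom C f = Cod C k" "Dom C g = Cod C k"
  shows "f = g"
proof -
  have "f = (f \<cdot> k) \<cdot> inv k" using assms(2-) iso_ar by simp
  also have "\<dots> = (g \<cdot> k) \<cdot> inv k" using assms by simp
  also have "\<dots> = g" using assms(2-) iso_ar by simp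
  finally show ?thesis .
qed

lemma iso_cmp_cancel:
  assumes "k \<cdot> f = k \<cdot> g" "iso C k" "f \<in> Ar C" "g \<in> Ar C" "Cod C f = Dom C k" "Cod C g = Dom C k"
  shows "f = g"
proof -
  have "f = inv k \<cdot> (k \<cdot> f)" using assms(2-) iso_ar by simp
  also have "\<dots> = inv k \<cdot> (k \<cdot> g)" using assms(1) by simp
  also have "\<dots> = g" using assms(2-) iso_ar by simp
  finally show ?thesis .
qed

text \<open>Applies an equation between two composites at the head of a longer one. The domain of
  \<open>f'\<close> is read off from the equation itself.\<close>

lemma cmp_cmp_eq:
  assumes "g \<cdot> f = g' \<cdot> f'" "f \<in> Ar C" "g \<in> Ar C" "Dom C g = Cod C f"
    "f' \<in> Ar C" "g' \<in> Ar C" "Dom C g' = Cod C f'" "k \<in> Ar C" "Cod C k = Dom C f"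
  shows "g \<cdot> (f \<cdot> k) = g' \<cdot> (f' \<cdot> k)"
proof -
  have "Dom C f' = Dom C f"
    using assms dom_cmp by metis
  then show ?thesis
    using assms by (metis assoc_cmp)
qed

lemma cmp_cmp_eq1:
  assumes "g \<cdot> f = h" "f \<in> Ar C" "g \<in> Ar C" "Dom C g = Cod C f" "k \<in> Ar C" "Cod C k = Dom C f"
  shows "g \<cdot> (f \<cdot> k) = h \<cdot> k"
  using assms by (metis assoc_cmp)

end

section \<open>Denumerable coproducts and categories of structured objects\<close>

lemma coproduct_ex:
  assumes "is_coproduct C F X i" "Y \<in> Ob C" "\<And>n. g n \<in> Hom C (F n) Y"
  obtains h where "h \<in> Hom C X Y" "\<And>n. h \<cdot>\<^bsub>C\<^esub> i n = g n"
proof -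
  have "\<exists>!h. h \<in> Hom C X Y \<and> (\<forall>n. h \<cdot>\<^bsub>C\<^esub> i n = g n)"
    using assms unfolding is_coproduct_def by blast
  then show ?thesis using that by blast
qed

text \<open>The injections are jointly epic: \<open>f\<close> and \<open>g\<close> both mediate the
  family \<open>g \<cdot> i n\<close>, and the mediating arrow is unique.\<close>

lemma (in category) coproduct_eqI:
  assumes "is_coproduct C F X i" "f \<in> Hom C X Y" "g \<in> Hom C X Y" "\<And>n. f \<cdot> i n = g \<cdot> i n"
  shows "f = g"
proof -
  have "i n \<in> Hom C (F n) X" for n
    using assms(1) by (simp add: is_coproduct_def)
  then have gi: "g \<cdot> i n \<in> Hom C (F n) Y" for n
    using assms(3) cmp_hom by blast
  have "Y \<in> Ob C"
    using assms(2) cod_ob by (auto simp: Hom_iff)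
  with gi have "\<exists>!h. h \<in> Hom C X Y \<and> (\<forall>n. h \<cdot> i n = g \<cdot> i n)"
    using assms(1)[unfolded is_coproduct_def, THEN conjunct2, THEN conjunct2, THEN conjunct2,
        rule_format, of Y "\<lambda>n. g \<cdot> i n"] by simp
  then show ?thesis
    using assms(2-4) by metis
qed

text \<open>The category laws are inherited from \<open>C\<close>; only the closure of
  \<open>P\<close> under identities and composition has to be supplied.\<close>

lemma (in category) category_structure_cat:
  assumes "\<And>X. X \<in> A \<Longrightarrow> U X \<in> Ob C"
    and "\<And>X. X \<in> A \<Longrightarrow> P X (\<iota> (U X)) X"
    and "\<And>X Y Z f g. \<lbrakk>X \<in> A; Y \<in> A; Z \<in> A; f \<in> Hom C (U X) (U Y); g \<in> Hom C (U Y) (U Z);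
      P X f Y; P Y g Z\<rbrakk> \<Longrightarrow> P X (g \<cdot> f) Z"
  shows "category (structure_cat C A U P)"
proof unfold_locales
  fix f X Y g Z
  assume "f \<in> Hom (structure_cat C A U P) X Y" "g \<in> Hom (structure_cat C A U P) Y Z"
  then show "g \<cdot>\<^bsub>structure_cat C A U P\<^esub> f \<in> Hom (structure_cat C A U P) X Z"
    using assms(3)[of X Y Z] by (auto simp: structure_cat_def Hom_iff)
qed (auto simp: structure_cat_def Hom_iff assms(1,2))


section \<open>Coherence in a braided monoidal category\<close>

context braided_monoidal_category
begin

declare tensor_ob [simp] unit_ob [simp] assoc_iso [simp] lunit_iso [simp] runit_iso [simp]
  braid_iso [simp] tensor_ident [simp]

lemma tensor_ar [simp]: "\<lbrakk>f \<in> Ar M; g \<in> Ar M\<rbrakk> \<Longrightarrow> f \<boxtimes> g \<in> Ar M"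
  and dom_tensor [simp]: "\<lbrakk>f \<in> Ar M; g \<in> Ar M\<rbrakk> \<Longrightarrow> Dom M (f \<boxtimes> g) = Dom M f \<otimes> Dom M g"
  and cod_tensor [simp]: "\<lbrakk>f \<in> Ar M; g \<in> Ar M\<rbrakk> \<Longrightarrow> Cod M (f \<boxtimes> g) = Cod M f \<otimes> Cod M g"
  using tensor_hom[of f "Dom M f" "Cod M f" g "Dom M g" "Cod M g"] by (auto simp: Hom_iff)

lemma tensor_interchange [simp]:
  "\<lbrakk>f \<in> Ar M; f' \<in> Ar M; Dom M f' = Cod M f; g \<in> Ar M; g' \<in> Ar M; Dom M g' = Cod M g\<rbrakk>
    \<Longrightarrow> (f' \<boxtimes> g') \<cdot> (f \<boxtimes> g) = (f' \<cdot> f) \<boxtimes> (g' \<cdot> g)"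
  using tensor_cmp by (simp add: Hom_iff)

lemma tensor_interchange_cmp [simp]:
  "\<lbrakk>f \<in> Ar M; f' \<in> Ar M; Dom M f' = Cod M f; g \<in> Ar M; g' \<in> Ar M; Dom M g' = Cod M g;
    k \<in> Ar M; Cod M k = Dom M f \<otimes> Dom M g\<rbrakk>
    \<Longrightarrow> (f' \<boxtimes> g') \<cdot> ((f \<boxtimes> g) \<cdot> k) = ((f' \<cdot> f) \<boxtimes> (g' \<cdot> g)) \<cdot> k"
  by (subst assoc_cmp[symmetric]) simp_all

lemma iso_tensor [simp]: "\<lbrakk>iso M f; iso M g\<rbrakk> \<Longrightarrow> iso M (f \<boxtimes> g)"
  by (rule isoI[of _ "inv f \<boxtimes> inv g"]) (auto simp: iso_ar)

lemma assoc_ar [simp]: "\<lbrakk>X \<in> Ob M; Y \<in> Ob M; Z \<in> Ob M\<rbrakk> \<Longrightarrow> \<a> X Y Z \<in> Ar M"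
  and dom_assoc [simp]: "\<lbrakk>X \<in> Ob M; Y \<in> Ob M; Z \<in> Ob M\<rbrakk> \<Longrightarrow> Dom M (\<a> X Y Z) = (X \<otimes> Y) \<otimes> Z"
  and cod_assoc [simp]: "\<lbrakk>X \<in> Ob M; Y \<in> Ob M; Z \<in> Ob M\<rbrakk> \<Longrightarrow> Cod M (\<a> X Y Z) = X \<otimes> (Y \<otimes> Z)"
  using assoc_hom by (auto simp: Hom_iff)

lemma lunit_ar [simp]: "X \<in> Ob M \<Longrightarrow> \<l> X \<in> Ar M"
  and dom_lunit [simp]: "X \<in> Ob M \<Longrightarrow> Dom M (\<l> X) = \<one> \<otimes> X"
  and cod_lunit [simp]: "X \<in> Ob M \<Longrightarrow> Cod M (\<l> X) = X"
  using lunit_hom by (auto simp: Hom_iff)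

lemma runit_ar [simp]: "X \<in> Ob M \<Longrightarrow> \<r> X \<in> Ar M"
  and dom_runit [simp]: "X \<in> Ob M \<Longrightarrow> Dom M (\<r> X) = X \<otimes> \<one>"
  and cod_runit [simp]: "X \<in> Ob M \<Longrightarrow> Cod M (\<r> X) = X"
  using runit_hom by (auto simp: Hom_iff)

lemma braid_ar [simp]: "\<lbrakk>X \<in> Ob M; Y \<in> Ob M\<rbrakk> \<Longrightarrow> \<c> X Y \<in> Ar M"
  and dom_braid [simp]: "\<lbrakk>X \<in> Ob M; Y \<in> Ob M\<rbrakk> \<Longrightarrow> Dom M (\<c> X Y) = X \<otimes> Y"
  and cod_braid [simp]: "\<lbrakk>X \<in> Ob M; Y \<in> Ob M\<rbrakk> \<Longrightarrow> Cod M (\<c> X Y) = Y \<otimes> X"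
  using braid_hom by (auto simp: Hom_iff)

section \<open>Naturality of the constraints and of the braiding\<close>

lemma assoc_natural:
  "\<lbrakk>f \<in> Ar M; g \<in> Ar M; h \<in> Ar M; X' = Cod M f; Y' = Cod M g; Z' = Cod M h\<rbrakk>
    \<Longrightarrow> \<a> X' Y' Z' \<cdot> ((f \<boxtimes> g) \<boxtimes> h) = (f \<boxtimes> (g \<boxtimes> h)) \<cdot> \<a> (Dom M f) (Dom M g) (Dom M h)"
  using assoc_nat by (simp add: Hom_iff)

lemma assoc_natural_cmp:
  assumes "f \<in> Ar M" "g \<in> Ar M" "h \<in> Ar M" "X' = Cod M f" "Y' = Cod M g" "Z' = Cod M h"
    "k \<in> Ar M" "Cod M k = (Dom M f \<otimes> Dom M g) \<otimes> Dom M h"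
  shows "\<a> X' Y' Z' \<cdot> (((f \<boxtimes> g) \<boxtimes> h) \<cdot> k)
    = (f \<boxtimes> (g \<boxtimes> h)) \<cdot> (\<a> (Dom M f) (Dom M g) (Dom M h) \<cdot> k)"
  by (rule cmp_cmp_eq[OF assoc_natural]) (use assms in simp_all)

lemma assoc_inv_natural:
  assumes "f \<in> Ar M" "g \<in> Ar M" "h \<in> Ar M" "X' = Cod M f" "Y' = Cod M g" "Z' = Cod M h"
  shows "inv (\<a> X' Y' Z') \<cdot> (f \<boxtimes> (g \<boxtimes> h))
    = ((f \<boxtimes> g) \<boxtimes> h) \<cdot> inv (\<a> (Dom M f) (Dom M g) (Dom M h))"
  by (rule iso_cmp_cancel[where k = "\<a> X' Y' Z'"]) (use assms in \<open>simp_all add: assoc_natural_cmp\<close>)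

lemma assoc_inv_natural_cmp:
  assumes "f \<in> Ar M" "g \<in> Ar M" "h \<in> Ar M" "X' = Cod M f" "Y' = Cod M g" "Z' = Cod M h"
    "k \<in> Ar M" "Cod M k = Dom M f \<otimes> (Dom M g \<otimes> Dom M h)"
  shows "inv (\<a> X' Y' Z') \<cdot> ((f \<boxtimes> (g \<boxtimes> h)) \<cdot> k)
    = ((f \<boxtimes> g) \<boxtimes> h) \<cdot> (inv (\<a> (Dom M f) (Dom M g) (Dom M h)) \<cdot> k)"
  by (rule cmp_cmp_eq[OF assoc_inv_natural]) (use assms in simp_all)

lemma lunit_natural: "\<lbrakk>f \<in> Ar M; Y = Cod M f\<rbrakk> \<Longrightarrow> \<l> Y \<cdot> (\<iota> \<one> \<boxtimes> f) = f \<cdot> \<l> (Dom M f)"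
  using lunit_nat by (simp add: Hom_iff)

lemma runit_natural: "\<lbrakk>f \<in> Ar M; Y = Cod M f\<rbrakk> \<Longrightarrow> \<r> Y \<cdot> (f \<boxtimes> \<iota> \<one>) = f \<cdot> \<r> (Dom M f)"
  using runit_nat by (simp add: Hom_iff)

lemma braid_natural:
  "\<lbrakk>f \<in> Ar M; g \<in> Ar M; X' = Cod M f; Y' = Cod M g\<rbrakk>
    \<Longrightarrow> \<c> X' Y' \<cdot> (f \<boxtimes> g) = (g \<boxtimes> f) \<cdot> \<c> (Dom M f) (Dom M g)"
  using braid_nat by (simp add: Hom_iff)

section \<open>Coherence of the unit constraints\<close>

lemma unit_tensor_cancel:
  assumes "\<iota> \<one> \<boxtimes> f = \<iota> \<one> \<boxtimes> g" "f \<in> Ar M" "g \<in> Ar M" "Dom M f = Dom M g" "Cod M f = Cod M g"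
  shows "f = g"
proof (rule cmp_iso_cancel)
  \<comment> \<open>Tensoring with the unit is faithful, because naturality of \<open>\<l>\<close>
    recovers an arrow from its tensor product with the unit.\<close>
  show "f \<cdot> \<l> (Dom M f) = g \<cdot> \<l> (Dom M f)"
    using assms lunit_natural by metis
qed (use assms in auto)

lemma tensor_unit_cancel:
  assumes "f \<boxtimes> \<iota> \<one> = g \<boxtimes> \<iota> \<one>" "f \<in> Ar M" "g \<in> Ar M" "Dom M f = Dom M g" "Cod M f = Cod M g"
  shows "f = g"
proof (rule cmp_iso_cancel)
  show "f \<cdot> \<r> (Dom M f) = g \<cdot> \<r> (Dom M f)"
    using assms runit_natural by metis
qed (use assms in auto)

text \<open>The pentagon rearranged for inverse associators, which are the ones in the recursion for
  \<open>tmerge\<close>.\<close>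

lemma pentagon_inv:
  assumes [simp]: "W \<in> Ob M" "X \<in> Ob M" "Y \<in> Ob M" "Z \<in> Ob M"
  shows "inv (\<a> W (X \<otimes> Y) Z) \<cdot> (\<iota> W \<boxtimes> inv (\<a> X Y Z)) \<cdot> \<a> W X (Y \<otimes> Z)
    = (\<a> W X Y \<boxtimes> \<iota> Z) \<cdot> inv (\<a> (W \<otimes> X) Y Z)"
proof (rule cmp_iso_cancel[where k = "\<a> (W \<otimes> X) Y Z"])
  show "(inv (\<a> W (X \<otimes> Y) Z) \<cdot> (\<iota> W \<boxtimes> inv (\<a> X Y Z)) \<cdot> \<a> W X (Y \<otimes> Z)) \<cdot> \<a> (W \<otimes> X) Y Z
    = ((\<a> W X Y \<boxtimes> \<iota> Z) \<cdot> inv (\<a> (W \<otimes> X) Y Z)) \<cdot> \<a> (W \<otimes> X) Y Z"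
    by (simp add: pentagon)
qed simp_all

text \<open>Kelly's argument: after tensoring with \<open>\<one>\<close> on the left, the pentagon
  makes both triangles available, and the invertible arrow \<open>?K\<close> can be
  cancelled.\<close>

lemma lunit_tensor:
  assumes [simp]: "X \<in> Ob M" "Y \<in> Ob M"
  shows "\<l> (X \<otimes> Y) \<cdot> \<a> \<one> X Y = \<l> X \<boxtimes> \<iota> Y"
proof (rule unit_tensor_cancel)
  let ?K = "\<a> \<one> (\<one> \<otimes> X) Y \<cdot> (\<a> \<one> \<one> X \<boxtimes> \<iota> Y)"
  have "(\<iota> \<one> \<boxtimes> (\<l> (X \<otimes> Y) \<cdot> \<a> \<one> X Y)) \<cdot> ?K
    = (\<iota> \<one> \<boxtimes> \<l> (X \<otimes> Y)) \<cdot> ((\<iota> \<one> \<boxtimes> \<a> \<one> X Y) \<cdot> ?K)"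
    by simp
  also have "\<dots> = (\<iota> \<one> \<boxtimes> \<l> (X \<otimes> Y)) \<cdot> (\<a> \<one> \<one> (X \<otimes> Y) \<cdot> \<a> (\<one> \<otimes> \<one>) X Y)"
    by (simp only: pentagon assms unit_ob)
  also have "\<dots> = (\<r> \<one> \<boxtimes> \<iota> (X \<otimes> Y)) \<cdot> \<a> (\<one> \<otimes> \<one>) X Y"
    by (rule cmp_cmp_eq1[OF triangle]) simp_all
  also have "\<dots> = \<a> \<one> X Y \<cdot> ((\<r> \<one> \<boxtimes> \<iota> X) \<boxtimes> \<iota> Y)"
    by (simp add: assoc_natural)
  also have "\<dots> = \<a> \<one> X Y \<cdot> (((\<iota> \<one> \<boxtimes> \<l> X) \<boxtimes> \<iota> Y) \<cdot> (\<a> \<one> \<one> X \<boxtimes> \<iota> Y))"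
    by (simp add: triangle)
  also have "\<dots> = (\<iota> \<one> \<boxtimes> (\<l> X \<boxtimes> \<iota> Y)) \<cdot> ?K"
    by (subst assoc_natural_cmp) simp_all
  finally show "\<iota> \<one> \<boxtimes> (\<l> (X \<otimes> Y) \<cdot> \<a> \<one> X Y) = \<iota> \<one> \<boxtimes> (\<l> X \<boxtimes> \<iota> Y)"
    by (rule cmp_iso_cancel) simp_all
qed simp_all

text \<open>The mirror image of \<open>lunit_tensor\<close>: tensor with \<open>\<one>\<close> on
  the right and cancel the associator on the left.\<close>

lemma runit_tensor:
  assumes [simp]: "X \<in> Ob M" "Y \<in> Ob M"
  shows "(\<iota> X \<boxtimes> \<r> Y) \<cdot> \<a> X Y \<one> = \<r> (X \<otimes> Y)"
proof (rule tensor_unit_cancel)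
  have "\<a> X Y \<one> \<cdot> (((\<iota> X \<boxtimes> \<r> Y) \<cdot> \<a> X Y \<one>) \<boxtimes> \<iota> \<one>)
      = \<a> X Y \<one> \<cdot> (((\<iota> X \<boxtimes> \<r> Y) \<boxtimes> \<iota> \<one>) \<cdot> (\<a> X Y \<one> \<boxtimes> \<iota> \<one>))"
    by simp
  also have "\<dots> = (\<iota> X \<boxtimes> (\<r> Y \<boxtimes> \<iota> \<one>)) \<cdot> (\<a> X (Y \<otimes> \<one>) \<one> \<cdot> (\<a> X Y \<one> \<boxtimes> \<iota> \<one>))"
    by (subst assoc_natural_cmp) simp_all
  also have "\<dots> = (\<iota> X \<boxtimes> (\<iota> Y \<boxtimes> \<l> \<one>)) \<cdot> ((\<iota> X \<boxtimes> \<a> Y \<one> \<one>) \<cdot> (\<a> X (Y \<otimes> \<one>) \<one> \<cdot> (\<a> X Y \<one> \<boxtimes> \<iota> \<one>)))"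
    by (simp add: triangle)
  also have "\<dots> = (\<iota> X \<boxtimes> (\<iota> Y \<boxtimes> \<l> \<one>)) \<cdot> (\<a> X Y (\<one> \<otimes> \<one>) \<cdot> \<a> (X \<otimes> Y) \<one> \<one>)"
    by (simp only: pentagon assms unit_ob)
  also have "\<dots> = \<a> X Y \<one> \<cdot> ((\<iota> (X \<otimes> Y) \<boxtimes> \<l> \<one>) \<cdot> \<a> (X \<otimes> Y) \<one> \<one>)"
    unfolding tensor_ident[OF assms, symmetric]
    by (subst assoc_natural_cmp) (simp_all del: tensor_ident)
  also have "\<dots> = \<a> X Y \<one> \<cdot> (\<r> (X \<otimes> Y) \<boxtimes> \<iota> \<one>)"
    by (simp only: triangle assms unit_ob tensor_ob)
  finally show "((\<iota> X \<boxtimes> \<r> Y) \<cdot> \<a> X Y \<one>) \<boxtimes> \<iota> \<one> = \<r> (X \<otimes> Y) \<boxtimes> \<iota> \<one>"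
    by (rule iso_cmp_cancel) simp_all
qed simp_all

lemma lunit_unit_eq_runit: "\<l> \<one> = \<r> \<one>"
proof (rule tensor_unit_cancel)
  \<comment> \<open>Naturality of \<open>\<l>\<close> at the arrow \<open>\<l> \<one>\<close>
    itself. It lets \<open>lunit_tensor\<close> and the triangle be compared.\<close>
  have "\<l> (\<one> \<otimes> \<one>) = \<iota> \<one> \<boxtimes> \<l> \<one>"
    by (rule iso_cmp_cancel[where k = "\<l> \<one>"]) (simp_all add: lunit_natural)
  then show "\<l> \<one> \<boxtimes> \<iota> \<one> = \<r> \<one> \<boxtimes> \<iota> \<one>"
    using lunit_tensor[of \<one> \<one>] triangle[of \<one> \<one>] by simp
qed simp_all

section \<open>Hexagons and the Yang-Baxter equation\<close>

lemma lwhisk_ar [simp]: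
  assumes "X \<in> Ob M" "Y \<in> Ob M" "Z \<in> Ob M" "f \<in> Hom M (Y \<otimes> Z) (Z \<otimes> Y)"
  shows "lwhisk M X Y Z f \<in> Ar M"
    and "Dom M (lwhisk M X Y Z f) = (X \<otimes> Y) \<otimes> Z"
    and "Cod M (lwhisk M X Y Z f) = (X \<otimes> Z) \<otimes> Y"
  using assms by (simp_all add: lwhisk_def Hom_iff)

text \<open>The first hexagon in terms of \<open>lwhisk\<close>, the form taken by the axioms of
  braided algebras and of \<open>is_tpow_braiding\<close>.\<close>

lemma hexagon_lwhisk1:
  assumes [simp]: "X \<in> Ob M" "Y \<in> Ob M" "Z \<in> Ob M"
  shows "\<c> X (Y \<otimes> Z) \<cdot> \<a> X Y Z = lwhisk M Y X Z (\<c> X Z) \<cdot> (\<c> X Y \<boxtimes> \<iota> Z)"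
  by (rule iso_cmp_cancel[where k = "\<a> Y Z X"]) (simp_all add: hexagon1 lwhisk_def Hom_iff)

lemma hexagon_lwhisk2:
  assumes [simp]: "X \<in> Ob M" "Y \<in> Ob M" "Z \<in> Ob M"
  shows "\<a> Z X Y \<cdot> (\<c> X Z \<boxtimes> \<iota> Y) \<cdot> lwhisk M X Y Z (\<c> Y Z) = \<c> (X \<otimes> Y) Z"
proof -
  have "\<a> Z X Y \<cdot> (\<c> X Z \<boxtimes> \<iota> Y) \<cdot> lwhisk M X Y Z (\<c> Y Z)
    = \<a> Z X Y \<cdot> ((\<c> X Z \<boxtimes> \<iota> Y) \<cdot> inv (\<a> X Z Y) \<cdot> (\<iota> X \<boxtimes> \<c> Y Z)) \<cdot> \<a> X Y Z"
    by (simp add: lwhisk_def)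
  also have "\<dots> = \<c> (X \<otimes> Y) Z"
    by (simp flip: hexagon2)
  finally show ?thesis .
qed

text \<open>The second hexagon merges the two crossings with \<open>Z\<close> into one crossing of
  \<open>Z\<close> with a tensor product; naturality then slides \<open>\<c> X Y\<close> through it,
  and the hexagon splits it again.\<close>

lemma yang_baxter_braid:
  assumes [simp]: "X \<in> Ob M" "Y \<in> Ob M" "Z \<in> Ob M"
  shows "lwhisk M Z X Y (\<c> X Y) \<cdot> (\<c> X Z \<boxtimes> \<iota> Y) \<cdot> lwhisk M X Y Z (\<c> Y Z)
    = (\<c> Y Z \<boxtimes> \<iota> X) \<cdot> lwhisk M Y X Z (\<c> X Z) \<cdot> (\<c> X Y \<boxtimes> \<iota> Z)"
proof (rule iso_cmp_cancel[where k = "\<a> Z Y X"])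
  have "\<a> Z Y X \<cdot> lwhisk M Z X Y (\<c> X Y) \<cdot> (\<c> X Z \<boxtimes> \<iota> Y) \<cdot> lwhisk M X Y Z (\<c> Y Z)
    = (\<iota> Z \<boxtimes> \<c> X Y) \<cdot> \<c> (X \<otimes> Y) Z"
    unfolding hexagon_lwhisk2[OF assms, symmetric]
    by (subst lwhisk_def) (simp add: Hom_iff)
  also have "\<dots> = \<c> (Y \<otimes> X) Z \<cdot> (\<c> X Y \<boxtimes> \<iota> Z)"
    by (simp add: braid_natural)
  also have "\<dots> = (\<a> Z Y X \<cdot> (\<c> Y Z \<boxtimes> \<iota> X) \<cdot> lwhisk M Y X Z (\<c> X Z)) \<cdot> (\<c> X Y \<boxtimes> \<iota> Z)"
    by (simp only: hexagon_lwhisk2 assms)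
  also have "\<dots> = \<a> Z Y X \<cdot> (\<c> Y Z \<boxtimes> \<iota> X) \<cdot> lwhisk M Y X Z (\<c> X Z) \<cdot> (\<c> X Y \<boxtimes> \<iota> Z)"
    by (simp add: Hom_iff)
  finally show "\<a> Z Y X \<cdot> lwhisk M Z X Y (\<c> X Y) \<cdot> (\<c> X Z \<boxtimes> \<iota> Y) \<cdot> lwhisk M X Y Z (\<c> Y Z)
    = \<a> Z Y X \<cdot> (\<c> Y Z \<boxtimes> \<iota> X) \<cdot> lwhisk M Y X Z (\<c> X Z) \<cdot> (\<c> X Y \<boxtimes> \<iota> Z)" .
qed (simp_all add: Hom_iff)

section \<open>The braiding and the unit object\<close>

lemma runit_braid:
  assumes [simp]: "X \<in> Ob M"
  shows "\<r> X \<cdot> \<c> \<one> X = \<l> X"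
proof (rule tensor_unit_cancel)
  \<comment> \<open>\<open>?K\<close> is the first crossing in the second hexagon for
    \<open>\<c> (\<one> \<otimes> \<one>) X\<close>. Naturality along \<open>\<l> \<one>\<close>
    collapses this braiding to \<open>\<c> \<one> X\<close>; \<open>?K\<close> is invertible because
    the braiding is, so it can be cancelled at the end.\<close>
  let ?K = "inv (\<a> \<one> X \<one>) \<cdot> (\<iota> \<one> \<boxtimes> \<c> \<one> X) \<cdot> \<a> \<one> \<one> X"
  have "((\<r> X \<cdot> \<c> \<one> X) \<boxtimes> \<iota> \<one>) \<cdot> ?K = (\<r> X \<boxtimes> \<iota> \<one>) \<cdot> (\<c> \<one> X \<boxtimes> \<iota> \<one>) \<cdot> ?K"
    by simp
  also have "\<dots> = (\<iota> X \<boxtimes> \<l> \<one>) \<cdot> \<a> X \<one> \<one> \<cdot> (\<c> \<one> X \<boxtimes> \<iota> \<one>) \<cdot> ?K"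
    by (simp flip: triangle)
  also have "\<dots> = (\<iota> X \<boxtimes> \<l> \<one>) \<cdot> \<c> (\<one> \<otimes> \<one>) X"
    by (simp flip: hexagon_lwhisk2 add: lwhisk_def)
  also have "\<dots> = \<c> \<one> X \<cdot> (\<l> \<one> \<boxtimes> \<iota> X)"
    by (simp add: braid_natural)
  also have "\<dots> = \<c> \<one> X \<cdot> \<l> (\<one> \<otimes> X) \<cdot> \<a> \<one> \<one> X"
    by (simp add: lunit_tensor)
  also have "\<dots> = \<l> (X \<otimes> \<one>) \<cdot> (\<iota> \<one> \<boxtimes> \<c> \<one> X) \<cdot> \<a> \<one> \<one> X"
    by (rule cmp_cmp_eq) (simp_all add: lunit_natural)
  also have "\<dots> = (\<l> (X \<otimes> \<one>) \<cdot> \<a> \<one> X \<one>) \<cdot> ?K"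
    by simp
  also have "\<dots> = (\<l> X \<boxtimes> \<iota> \<one>) \<cdot> ?K"
    by (simp only: lunit_tensor assms unit_ob)
  finally show "(\<r> X \<cdot> \<c> \<one> X) \<boxtimes> \<iota> \<one> = \<l> X \<boxtimes> \<iota> \<one>"
    by (rule cmp_iso_cancel) simp_all
qed simp_all

lemma lunit_braid:
  assumes [simp]: "X \<in> Ob M"
  shows "\<l> X \<cdot> \<c> X \<one> = \<r> X"
proof (rule unit_tensor_cancel)
  \<comment> \<open>The same argument with the first hexagon: \<open>?K\<close> contains the first
    crossing for \<open>\<c> X (\<one> \<otimes> \<one>)\<close>, which is collapsed along
    \<open>\<r> \<one>\<close>.\<close>
  let ?K = "\<a> \<one> X \<one> \<cdot> (\<c> X \<one> \<boxtimes> \<iota> \<one>)"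
  have "(\<iota> \<one> \<boxtimes> (\<l> X \<cdot> \<c> X \<one>)) \<cdot> ?K
      = ((\<iota> \<one> \<boxtimes> \<l> X) \<cdot> \<a> \<one> \<one> X) \<cdot> inv (\<a> \<one> \<one> X) \<cdot> (\<iota> \<one> \<boxtimes> \<c> X \<one>) \<cdot> ?K"
    by simp
  also have "\<dots> = (\<r> \<one> \<boxtimes> \<iota> X) \<cdot> inv (\<a> \<one> \<one> X) \<cdot> (\<iota> \<one> \<boxtimes> \<c> X \<one>) \<cdot> ?K"
    by (simp only: triangle assms unit_ob)
  also have "\<dots> = (\<r> \<one> \<boxtimes> \<iota> X) \<cdot> lwhisk M \<one> X \<one> (\<c> X \<one>) \<cdot> (\<c> X \<one> \<boxtimes> \<iota> \<one>)"
    by (simp add: lwhisk_def)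
  also have "\<dots> = (\<r> \<one> \<boxtimes> \<iota> X) \<cdot> \<c> X (\<one> \<otimes> \<one>) \<cdot> \<a> X \<one> \<one>"
    by (simp only: hexagon_lwhisk1 assms unit_ob)
  also have "\<dots> = \<c> X \<one> \<cdot> (\<iota> X \<boxtimes> \<r> \<one>) \<cdot> \<a> X \<one> \<one>"
    by (rule cmp_cmp_eq) (simp_all add: braid_natural)
  also have "\<dots> = \<c> X \<one> \<cdot> \<r> (X \<otimes> \<one>)"
    by (simp only: runit_tensor assms unit_ob)
  also have "\<dots> = \<r> (\<one> \<otimes> X) \<cdot> (\<c> X \<one> \<boxtimes> \<iota> \<one>)"
    by (simp add: runit_natural)
  also have "\<dots> = (\<iota> \<one> \<boxtimes> \<r> X) \<cdot> ?K"
    by (simp flip: runit_tensor)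
  finally show "\<iota> \<one> \<boxtimes> (\<l> X \<cdot> \<c> X \<one>) = \<iota> \<one> \<boxtimes> \<r> X"
    by (rule cmp_iso_cancel) simp_all
qed simp_all

lemma braid_unit_left:
  assumes [simp]: "X \<in> Ob M"
  shows "\<c> \<one> X \<cdot> inv (\<l> X) = inv (\<r> X)"
  by (rule iso_cmp_cancel[where k = "\<r> X"])
    (use cmp_cmp_eq1[OF runit_braid[OF assms], of "inv (\<l> X)"] in simp_all)

lemma braid_unit_right:
  assumes [simp]: "X \<in> Ob M"
  shows "\<c> X \<one> \<cdot> inv (\<r> X) = inv (\<l> X)"
  by (rule iso_cmp_cancel[where k = "\<l> X"])
    (use cmp_cmp_eq1[OF lunit_braid[OF assms], of "inv (\<r> X)"] in simp_all)

end


section \<open>Tensor powers\<close>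

context braided_monoidal_category
begin

text \<open>Both 0 and 1 are base cases of the induction, as in the recursion for
  \<open>tpow\<close>.\<close>

lemma tpow_ob [simp]: "V \<in> Ob M \<Longrightarrow> tpow M V n \<in> Ob M"
  by (induction n rule: induct_nat_012) simp_all

lemma tmerge_iso_hom:
  assumes "V \<in> Ob M"
  shows "iso M (tmerge M V m n) \<and> tmerge M V m n \<in> Hom M (tpow M V m \<otimes> tpow M V n) (tpow M V (m + n))"
  using assms
proof (induction n rule: induct_nat_012)
  case 0
  then show ?case by (simp add: Hom_iff)
next
  case 1
  then show ?case by (cases m) (simp_all add: Hom_iff)
next
  case (ge2 n)
  then show ?case by (simp add: Hom_iff)
qed

lemma
  assumes "V \<in> Ob M"
  shows tmerge_iso [simp]: "iso M (tmerge M V m n)"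
    and tmerge_ar [simp]: "tmerge M V m n \<in> Ar M"
    and dom_tmerge [simp]: "Dom M (tmerge M V m n) = tpow M V m \<otimes> tpow M V n"
    and cod_tmerge [simp]: "Cod M (tmerge M V m n) = tpow M V (m + n)"
  using tmerge_iso_hom[OF assms] by (simp_all add: Hom_iff)

text \<open>Since \<open>tpow V 1\<close> is \<open>V\<close> and not \<open>\<one> \<otimes> V\<close>, the arrow \<open>tmerge V n 1\<close> is \<open>\<l> V\<close> for \<open>n = 0\<close>
  and an identity otherwise; carrying it along makes the recursion for \<open>tmerge\<close> uniform in \<open>n\<close>.\<close>

lemma tmerge_Suc:
  assumes [simp]: "V \<in> Ob M"
  shows "tmerge M V m (Suc n) \<cdot> (\<iota> (tpow M V m) \<boxtimes> tmerge M V n 1)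
    = tmerge M V (m + n) 1 \<cdot> (tmerge M V m n \<boxtimes> \<iota> V) \<cdot> inv (\<a> (tpow M V m) (tpow M V n) V)"
proof (cases n)
  case 0
  \<comment> \<open>For \<open>n = 0\<close> the recursion is the triangle solved for the left unit
    constraint.\<close>
  have "\<iota> (tpow M V m) \<boxtimes> \<l> V = (\<r> (tpow M V m) \<boxtimes> \<iota> V) \<cdot> inv (\<a> (tpow M V m) \<one> V)"
    by (simp flip: triangle)
  with 0 show ?thesis by simp
next
  case (Suc k)
  then show ?thesis by simp
qed

declare tmerge.simps(2,3) [simp del]

text \<open>Makes the uniform recursion applicable in front of a further arrow. It takes over from
  the defining equations, now removed from the simplifier so that \<open>tmerge V n 1\<close> stays
  folded.\<close>

lemma tmerge_Suc_cmp:
  assumes [simp]: "V \<in> Ob M" and "k \<in> Ar M" "Cod M k = tpow M V m \<otimes> (tpow M V n \<otimes> V)"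
  shows "tmerge M V m (Suc n) \<cdot> (\<iota> (tpow M V m) \<boxtimes> tmerge M V n 1) \<cdot> k
    = tmerge M V (m + n) 1 \<cdot> (tmerge M V m n \<boxtimes> \<iota> V) \<cdot> inv (\<a> (tpow M V m) (tpow M V n) V) \<cdot> k"
proof -
  have "tmerge M V m (Suc n) \<cdot> (\<iota> (tpow M V m) \<boxtimes> tmerge M V n 1) \<cdot> k
      = (tmerge M V (m + n) 1 \<cdot> (tmerge M V m n \<boxtimes> \<iota> V) \<cdot> inv (\<a> (tpow M V m) (tpow M V n) V)) \<cdot> k"
    by (rule cmp_cmp_eq1[OF tmerge_Suc]) (use assms in simp_all)
  then show ?thesis using assms by simp
qed

text \<open>The recursion runs over the right argument, so the left unit law needs induction: it
  starts from \<open>\<l> \<one> = \<r> \<one>\<close> and continues with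
  \<open>lunit_tensor\<close>.\<close>

lemma tmerge_0_left:
  assumes [simp]: "V \<in> Ob M"
  shows "tmerge M V 0 n = \<l> (tpow M V n)"
proof (induction n)
  case 0
  show ?case by (simp add: lunit_unit_eq_runit)
next
  case (Suc n)
  show ?case
  proof (rule cmp_iso_cancel)
    have "tmerge M V 0 (Suc n) \<cdot> (\<iota> \<one> \<boxtimes> tmerge M V n 1)
        = tmerge M V n 1 \<cdot> (\<l> (tpow M V n) \<boxtimes> \<iota> V) \<cdot> inv (\<a> \<one> (tpow M V n) V)"
      using tmerge_Suc[of V 0 n] by (simp add: Suc)
    also have "\<dots> = tmerge M V n 1 \<cdot> \<l> (tpow M V n \<otimes> V)"
      by (simp flip: lunit_tensor)
    also have "\<dots> = \<l> (tpow M V (Suc n)) \<cdot> (\<iota> \<one> \<boxtimes> tmerge M V n 1)"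
      by (simp add: lunit_natural)
    finally show "tmerge M V 0 (Suc n) \<cdot> (\<iota> \<one> \<boxtimes> tmerge M V n 1)
      = \<l> (tpow M V (Suc n)) \<cdot> (\<iota> \<one> \<boxtimes> tmerge M V n 1)" .
  qed simp_all
qed

text \<open>Induction on \<open>n\<close>: the recursion peels off the last factor \<open>V\<close>,
  and the pentagon carries the associator past it. The base case is
  \<open>runit_tensor\<close>.\<close>

lemma tmerge_assoc:
  assumes [simp]: "V \<in> Ob M"
  shows "tmerge M V (l + m) n \<cdot> (tmerge M V l m \<boxtimes> \<iota> (tpow M V n))
    = tmerge M V l (m + n) \<cdot> (\<iota> (tpow M V l) \<boxtimes> tmerge M V m n)
      \<cdot> \<a> (tpow M V l) (tpow M V m) (tpow M V n)"
proof (induction n)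
  case 0
  show ?case by (simp add: runit_tensor runit_natural)
next
  case (Suc n)
  let ?L = "tpow M V l" and ?M = "tpow M V m" and ?N = "tpow M V n" and ?t = "tmerge M V"
  show ?case
  \<comment> \<open>Precomposing with the isomorphism
    \<open>\<iota> (?L \<otimes> ?M) \<boxtimes> ?t n 1\<close> exposes the factor that
    \<open>tmerge_Suc\<close> expects.\<close>
  proof (rule cmp_iso_cancel)
    have "(?t (l + m) (Suc n) \<cdot> (?t l m \<boxtimes> \<iota> (tpow M V (Suc n)))) \<cdot> (\<iota> (?L \<otimes> ?M) \<boxtimes> ?t n 1)
      = ?t (l + m) (Suc n) \<cdot> (\<iota> (tpow M V (l + m)) \<boxtimes> ?t n 1) \<cdot> (?t l m \<boxtimes> (\<iota> ?N \<boxtimes> \<iota> V))"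
      by simp
    also have "\<dots> = ?t (l + m + n) 1 \<cdot> (?t (l + m) n \<boxtimes> \<iota> V)
        \<cdot> inv (\<a> (tpow M V (l + m)) ?N V) \<cdot> (?t l m \<boxtimes> (\<iota> ?N \<boxtimes> \<iota> V))"
      by (subst tmerge_Suc_cmp) simp_all
    also have "\<dots> = ?t (l + m + n) 1 \<cdot> (?t (l + m) n \<boxtimes> \<iota> V)
        \<cdot> ((?t l m \<boxtimes> \<iota> ?N) \<boxtimes> \<iota> V) \<cdot> inv (\<a> (?L \<otimes> ?M) ?N V)"
      \<comment> \<open>\<open>tensor_ident\<close> is suspended so that the identity of
        \<open>?N \<otimes> V\<close> stays split and naturality can match it.\<close>
      by (subst assoc_inv_natural) (simp_all del: tensor_ident)
    also have "\<dots> = ?t (l + m + n) 1 \<cdot>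
        ((?t l (m + n) \<cdot> (\<iota> ?L \<boxtimes> ?t m n) \<cdot> \<a> ?L ?M ?N) \<boxtimes> \<iota> V) \<cdot> inv (\<a> (?L \<otimes> ?M) ?N V)"
      by (simp add: Suc)
    also have "\<dots> = ?t (l + m + n) 1 \<cdot> (?t l (m + n) \<boxtimes> \<iota> V) \<cdot> ((\<iota> ?L \<boxtimes> ?t m n) \<boxtimes> \<iota> V)
        \<cdot> (\<a> ?L ?M ?N \<boxtimes> \<iota> V) \<cdot> inv (\<a> (?L \<otimes> ?M) ?N V)"
      by simp
    also have "\<dots> = ?t (l + m + n) 1 \<cdot> (?t l (m + n) \<boxtimes> \<iota> V) \<cdot> ((\<iota> ?L \<boxtimes> ?t m n) \<boxtimes> \<iota> V)
        \<cdot> inv (\<a> ?L (?M \<otimes> ?N) V) \<cdot> (\<iota> ?L \<boxtimes> inv (\<a> ?M ?N V)) \<cdot> \<a> ?L ?M (?N \<otimes> V)"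
      by (simp only: pentagon_inv tpow_ob assms)
    also have "\<dots> = ?t (l + m + n) 1 \<cdot> (?t l (m + n) \<boxtimes> \<iota> V) \<cdot> inv (\<a> ?L (tpow M V (m + n)) V)
        \<cdot> (\<iota> ?L \<boxtimes> (?t m n \<boxtimes> \<iota> V)) \<cdot> (\<iota> ?L \<boxtimes> inv (\<a> ?M ?N V)) \<cdot> \<a> ?L ?M (?N \<otimes> V)"
      by (subst assoc_inv_natural_cmp) simp_all
    also have "\<dots> = ?t l (Suc (m + n)) \<cdot> (\<iota> ?L \<boxtimes> ?t (m + n) 1)
        \<cdot> (\<iota> ?L \<boxtimes> (?t m n \<boxtimes> \<iota> V)) \<cdot> (\<iota> ?L \<boxtimes> inv (\<a> ?M ?N V)) \<cdot> \<a> ?L ?M (?N \<otimes> V)"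
      by (subst tmerge_Suc_cmp) (simp_all add: add.assoc)
    also have "\<dots> = ?t l (Suc (m + n)) \<cdot>
        (\<iota> ?L \<boxtimes> (?t (m + n) 1 \<cdot> (?t m n \<boxtimes> \<iota> V) \<cdot> inv (\<a> ?M ?N V))) \<cdot> \<a> ?L ?M (?N \<otimes> V)"
      by simp
    also have "\<dots> = ?t l (Suc (m + n)) \<cdot>
        (\<iota> ?L \<boxtimes> (?t m (Suc n) \<cdot> (\<iota> ?M \<boxtimes> ?t n 1))) \<cdot> \<a> ?L ?M (?N \<otimes> V)"
      by (simp only: tmerge_Suc assms)
    also have "\<dots> = ?t l (Suc (m + n)) \<cdot> (\<iota> ?L \<boxtimes> ?t m (Suc n)) \<cdot>
        (\<iota> ?L \<boxtimes> (\<iota> ?M \<boxtimes> ?t n 1)) \<cdot> \<a> ?L ?M (?N \<otimes> V)"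
      by simp
    also have "\<dots> = ?t l (Suc (m + n)) \<cdot> (\<iota> ?L \<boxtimes> ?t m (Suc n)) \<cdot>
        \<a> ?L ?M (tpow M V (Suc n)) \<cdot> ((\<iota> ?L \<boxtimes> \<iota> ?M) \<boxtimes> ?t n 1)"
      by (subst assoc_natural) (simp_all del: tensor_ident)
    also have "\<dots> = (?t l (m + Suc n) \<cdot> (\<iota> ?L \<boxtimes> ?t m (Suc n)) \<cdot> \<a> ?L ?M (tpow M V (Suc n)))
        \<cdot> (\<iota> (?L \<otimes> ?M) \<boxtimes> ?t n 1)"
      by simp
    finally show "(?t (l + m) (Suc n) \<cdot> (?t l m \<boxtimes> \<iota> (tpow M V (Suc n)))) \<cdot> (\<iota> (?L \<otimes> ?M) \<boxtimes> ?t n 1)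
      = (?t l (m + Suc n) \<cdot> (\<iota> ?L \<boxtimes> ?t m (Suc n)) \<cdot> \<a> ?L ?M (tpow M V (Suc n)))
        \<cdot> (\<iota> (?L \<otimes> ?M) \<boxtimes> ?t n 1)" .
  qed (simp_all add: add.assoc)
qed

section \<open>Tensor powers of arrows and naturality of merging\<close>

lemma tpow_ar_hom:
  assumes "f \<in> Ar M"
  shows "tpow_ar M f n \<in> Hom M (tpow M (Dom M f) n) (tpow M (Cod M f) n)"
  using assms by (induction n rule: induct_nat_012) (simp_all add: Hom_iff)

lemma
  assumes "f \<in> Ar M"
  shows tpow_ar_ar [simp]: "tpow_ar M f n \<in> Ar M"
    and dom_tpow_ar [simp]: "Dom M (tpow_ar M f n) = tpow M (Dom M f) n"
    and cod_tpow_ar [simp]: "Cod M (tpow_ar M f n) = tpow M (Cod M f) n"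
  using tpow_ar_hom[OF assms] by (simp_all add: Hom_iff)

lemma tpow_ar_ident: "X \<in> Ob M \<Longrightarrow> tpow_ar M (\<iota> X) n = \<iota> (tpow M X n)"
  by (induction n rule: induct_nat_012) simp_all

lemma tpow_ar_cmp:
  "\<lbrakk>f \<in> Ar M; g \<in> Ar M; Dom M g = Cod M f\<rbrakk>
    \<Longrightarrow> tpow_ar M (g \<cdot> f) n = tpow_ar M g n \<cdot> tpow_ar M f n"
  by (induction n rule: induct_nat_012) simp_all

text \<open>For \<open>n = 0\<close> this is naturality of \<open>\<l>\<close>; for positive
  \<open>n\<close> both merging arrows are identities.\<close>

lemma tmerge_1_natural:
  assumes "f \<in> Ar M"
  shows "tpow_ar M f (Suc n) \<cdot> tmerge M (Dom M f) n 1
    = tmerge M (Cod M f) n 1 \<cdot> (tpow_ar M f n \<boxtimes> f)"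
  using assms by (cases n) (simp_all add: tmerge.simps(2) lunit_natural)

text \<open>This will make \<open>T_ar f\<close> multiplicative. The induction peels off the last
  factor as in \<open>tmerge_assoc\<close>, with naturality of the associator in place of the
  pentagon.\<close>

lemma tmerge_natural:
  assumes [simp]: "f \<in> Ar M"
  shows "tpow_ar M f (m + n) \<cdot> tmerge M (Dom M f) m n
    = tmerge M (Cod M f) m n \<cdot> (tpow_ar M f m \<boxtimes> tpow_ar M f n)"
proof (induction n)
  case 0
  show ?case by (simp add: runit_natural)
next
  case (Suc n)
  let ?X = "Dom M f" and ?Y = "Cod M f" and ?f = "tpow_ar M f"
  show ?case
  proof (rule cmp_iso_cancel)
    have "(?f (m + Suc n) \<cdot> tmerge M ?X m (Suc n)) \<cdot> (\<iota> (tpow M ?X m) \<boxtimes> tmerge M ?X n 1)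
      = ?f (Suc (m + n)) \<cdot> tmerge M ?X m (Suc n) \<cdot> (\<iota> (tpow M ?X m) \<boxtimes> tmerge M ?X n 1)"
      by simp
    also have "\<dots> = ?f (Suc (m + n)) \<cdot> tmerge M ?X (m + n) 1 \<cdot> (tmerge M ?X m n \<boxtimes> \<iota> ?X)
        \<cdot> inv (\<a> (tpow M ?X m) (tpow M ?X n) ?X)"
      by (subst tmerge_Suc) simp_all
    also have "\<dots> = tmerge M ?Y (m + n) 1 \<cdot> (?f (m + n) \<boxtimes> f) \<cdot> (tmerge M ?X m n \<boxtimes> \<iota> ?X)
        \<cdot> inv (\<a> (tpow M ?X m) (tpow M ?X n) ?X)"
      by (rule cmp_cmp_eq[OF tmerge_1_natural]) simp_all
    also have "\<dots> = tmerge M ?Y (m + n) 1 \<cdot> (tmerge M ?Y m n \<boxtimes> \<iota> ?Y) \<cdot> ((?f m \<boxtimes> ?f n) \<boxtimes> f)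
        \<cdot> inv (\<a> (tpow M ?X m) (tpow M ?X n) ?X)"
      by (simp add: Suc)
    also have "\<dots> = tmerge M ?Y (m + n) 1 \<cdot> (tmerge M ?Y m n \<boxtimes> \<iota> ?Y)
        \<cdot> inv (\<a> (tpow M ?Y m) (tpow M ?Y n) ?Y) \<cdot> (?f m \<boxtimes> (?f n \<boxtimes> f))"
      by (subst assoc_inv_natural) simp_all
    also have "\<dots> = tmerge M ?Y m (Suc n) \<cdot> (\<iota> (tpow M ?Y m) \<boxtimes> tmerge M ?Y n 1) \<cdot> (?f m \<boxtimes> (?f n \<boxtimes> f))"
      by (subst tmerge_Suc_cmp) simp_all
    also have "\<dots> = tmerge M ?Y m (Suc n) \<cdot> (?f m \<boxtimes> (tmerge M ?Y n 1 \<cdot> (?f n \<boxtimes> f)))"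
      by simp
    also have "\<dots> = tmerge M ?Y m (Suc n) \<cdot> (?f m \<boxtimes> (?f (Suc n) \<cdot> tmerge M ?X n 1))"
      by (simp only: tmerge_1_natural assms)
    also have "\<dots> = (tmerge M ?Y m (Suc n) \<cdot> (?f m \<boxtimes> ?f (Suc n))) \<cdot> (\<iota> (tpow M ?X m) \<boxtimes> tmerge M ?X n 1)"
      by simp
    finally show "(?f (m + Suc n) \<cdot> tmerge M ?X m (Suc n)) \<cdot> (\<iota> (tpow M ?X m) \<boxtimes> tmerge M ?X n 1)
      = (tmerge M ?Y m (Suc n) \<cdot> (?f m \<boxtimes> ?f (Suc n))) \<cdot> (\<iota> (tpow M ?X m) \<boxtimes> tmerge M ?X n 1)" .
  qed simp_all
qed


section \<open>The braiding of tensor powers\<close>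

lemma is_tpow_braiding_braid:
  assumes [simp]: "V \<in> Ob M"
  shows "is_tpow_braiding M V (\<c> V V) (\<lambda>m n. \<c> (tpow M V m) (tpow M V n))"
  unfolding is_tpow_braiding_def
proof (intro conjI allI impI)
  fix l m n :: nat
  let ?L = "tpow M V l" and ?M = "tpow M V m" and ?N = "tpow M V n"
  show "\<c> ?M ?N \<in> Hom M (?M \<otimes> ?N) (?N \<otimes> ?M)"
    by (simp add: Hom_iff)
  show "lwhisk M ?N ?L ?M (\<c> ?L ?M) \<cdot> (\<c> ?L ?N \<boxtimes> \<iota> ?M) \<cdot> lwhisk M ?L ?M ?N (\<c> ?M ?N)
    = (\<c> ?M ?N \<boxtimes> \<iota> ?L) \<cdot> lwhisk M ?M ?L ?N (\<c> ?L ?N) \<cdot> (\<c> ?L ?M \<boxtimes> \<iota> ?N)"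
    by (simp add: yang_baxter_braid)
  show "(\<iota> ?N \<boxtimes> tmerge M V l m) \<cdot> \<a> ?N ?L ?M \<cdot> (\<c> ?L ?N \<boxtimes> \<iota> ?M) \<cdot> lwhisk M ?L ?M ?N (\<c> ?M ?N)
    = \<c> (tpow M V (l + m)) ?N \<cdot> (tmerge M V l m \<boxtimes> \<iota> ?N)"
    by (simp add: hexagon_lwhisk2 braid_natural)
  show "(tmerge M V m n \<boxtimes> \<iota> ?L) \<cdot> lwhisk M ?M ?L ?N (\<c> ?L ?N) \<cdot> (\<c> ?L ?M \<boxtimes> \<iota> ?N)
    = \<c> ?L (tpow M V (m + n)) \<cdot> (\<iota> ?L \<boxtimes> tmerge M V m n) \<cdot> \<a> ?L ?M ?N"
    \<comment> \<open>The first hexagon turns the two crossings into one with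
      \<open>?M \<otimes> ?N\<close>; naturality along \<open>tmerge\<close> finishes.\<close>
    unfolding hexagon_lwhisk1[OF tpow_ob tpow_ob tpow_ob, OF assms assms assms, symmetric]
    by (rule cmp_cmp_eq) (simp_all add: braid_natural)
  show "\<c> (tpow M V 0) ?N \<cdot> inv (\<l> ?N) = inv (\<r> ?N)"
    by (simp add: braid_unit_left)
  show "\<c> ?N (tpow M V 0) \<cdot> inv (\<r> ?N) = inv (\<l> ?N)"
    by (simp add: braid_unit_right)
qed simp

text \<open>The unit conditions fix the values with an index 0. Additivity in the second index then
  determines \<open>c 1 n\<close> from \<open>c 1 1\<close>, and additivity in the first determines
  \<open>c m n\<close> from the values \<open>c 1 n\<close>.\<close>

lemma is_tpow_braiding_unique:
  assumes c: "is_tpow_braiding M V c\<^sub>V c" and d: "is_tpow_braiding M V c\<^sub>V d" and [simp]: "V \<in> Ob M"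
  shows "c = d"
proof -
  have [simp]: "c m n \<in> Ar M" "Dom M (c m n) = tpow M V m \<otimes> tpow M V n"
    "d m n \<in> Ar M" "Dom M (d m n) = tpow M V m \<otimes> tpow M V n" for m n
    using c d by (simp_all add: is_tpow_braiding_def Hom_iff)
  have left_0: "c 0 n = d 0 n" for n
    by (rule cmp_iso_cancel[where k = "inv (\<l> (tpow M V n))"])
      (use c d in \<open>simp_all add: is_tpow_braiding_def\<close>)
  have right_0: "c n 0 = d n 0" for n
    by (rule cmp_iso_cancel[where k = "inv (\<r> (tpow M V n))"])
      (use c d in \<open>simp_all add: is_tpow_braiding_def\<close>)
  have eq_1: "c 1 n = d 1 n" for n
  proof (induction n)
    case 0
    show ?case by (rule right_0)
  next
    case (Suc n)
    show ?case
    \<comment> \<open>Additivity is available only for nonzero indices; the value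
      \<open>c 1 1\<close> is prescribed instead.\<close>
    proof (cases "n = 0")
      case True
      then show ?thesis using c d by (simp add: is_tpow_braiding_def)
    next
      case False
      \<comment> \<open>\<open>?k\<close> is the identification through which additivity expresses
        \<open>c 1 (n + 1)\<close>; since it is invertible, that value is determined.\<close>
      let ?k = "(\<iota> (tpow M V 1) \<boxtimes> tmerge M V n 1) \<cdot> \<a> (tpow M V 1) (tpow M V n) (tpow M V 1)"
      have "e 1 (n + 1) \<cdot> ?k = (tmerge M V n 1 \<boxtimes> \<iota> (tpow M V 1))
          \<cdot> lwhisk M (tpow M V n) (tpow M V 1) (tpow M V 1) (e 1 1) \<cdot> (e 1 n \<boxtimes> \<iota> (tpow M V 1))"
        if "is_tpow_braiding M V c\<^sub>V e" for e
        using that False unfolding is_tpow_braiding_def by (metis One_nat_def nat.distinct(1))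
      from this[OF c] this[OF d] have "c 1 (n + 1) \<cdot> ?k = d 1 (n + 1) \<cdot> ?k"
        using c d Suc by (simp add: is_tpow_braiding_def)
      then have "c 1 (n + 1) = d 1 (n + 1)"
        by (rule cmp_iso_cancel) simp_all
      then show ?thesis by simp
    qed
  qed
  have "c m n = d m n" for m n
  proof (induction m)
    case 0
    show ?case by (rule left_0)
  next
    case (Suc m)
    show ?case
    proof (cases "m = 0")
      case True
      then show ?thesis using eq_1 by simp
    next
      case False
      let ?k = "tmerge M V m 1 \<boxtimes> \<iota> (tpow M V n)"
      have "e (m + 1) n \<cdot> ?k = (\<iota> (tpow M V n) \<boxtimes> tmerge M V m 1)
          \<cdot> \<a> (tpow M V n) (tpow M V m) (tpow M V 1) \<cdot> (e m n \<boxtimes> \<iota> (tpow M V 1))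
          \<cdot> lwhisk M (tpow M V m) (tpow M V 1) (tpow M V n) (e 1 n)"
        if "is_tpow_braiding M V c\<^sub>V e" for e
        using that False unfolding is_tpow_braiding_def by (metis One_nat_def nat.distinct(1))
      from this[OF c] this[OF d] have "c (m + 1) n \<cdot> ?k = d (m + 1) n \<cdot> ?k"
        using eq_1 Suc by simp
      then have "c (m + 1) n = d (m + 1) n"
        by (rule cmp_iso_cancel) simp_all
      then show ?thesis by simp
    qed
  qed
  then show ?thesis by blast
qed

lemma tpow_braiding_braid:
  assumes "V \<in> Ob M"
  shows "tpow_braiding M V (\<c> V V) = (\<lambda>m n. \<c> (tpow M V m) (tpow M V n))"
  unfolding tpow_braiding_def
  by (rule the_equality)
    (use is_tpow_braiding_braid[OF assms] is_tpow_braiding_unique[OF _ _ assms] in blast)+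

section \<open>Algebras as braided algebras\<close>

lemma braided_algebra_braid:
  assumes "algebra M (A, m, u)"
  shows "braided_algebra M (A, m, u, \<c> A A)"
proof -
  have [simp]: "A \<in> Ob M" "m \<in> Ar M" "Dom M m = A \<otimes> A" "Cod M m = A"
    "u \<in> Ar M" "Dom M u = \<one>" "Cod M u = A"
    using assms by (simp_all add: Hom_iff)
  \<comment> \<open>All four compatibilities are naturality of the braiding along \<open>m\<close>
    or \<open>u\<close>: the hexagons supply the crossings with \<open>A \<otimes> A\<close>, and
    the unit lemmas treat those with \<open>\<one>\<close>.\<close>
  have "\<c> A A \<cdot> (m \<boxtimes> \<iota> A) = (\<iota> A \<boxtimes> m) \<cdot> \<a> A A A \<cdot> (\<c> A A \<boxtimes> \<iota> A) \<cdot> lwhisk M A A A (\<c> A A)"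
    by (simp add: hexagon_lwhisk2 braid_natural)
  moreover have "\<c> A A \<cdot> (\<iota> A \<boxtimes> m) \<cdot> \<a> A A A
      = (m \<boxtimes> \<iota> A) \<cdot> lwhisk M A A A (\<c> A A) \<cdot> (\<c> A A \<boxtimes> \<iota> A)"
    unfolding hexagon_lwhisk1[OF \<open>A \<in> Ob M\<close> \<open>A \<in> Ob M\<close> \<open>A \<in> Ob M\<close>, symmetric]
    by (rule cmp_cmp_eq) (simp_all add: braid_natural)
  moreover have "\<c> A A \<cdot> (u \<boxtimes> \<iota> A) \<cdot> inv (\<l> A) = (\<iota> A \<boxtimes> u) \<cdot> \<c> \<one> A \<cdot> inv (\<l> A)"
    by (rule cmp_cmp_eq) (simp_all add: braid_natural)
  moreover have "\<c> A A \<cdot> (\<iota> A \<boxtimes> u) \<cdot> inv (\<r> A) = (u \<boxtimes> \<iota> A) \<cdot> \<c> A \<one> \<cdot> inv (\<r> A)"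
    by (rule cmp_cmp_eq) (simp_all add: braid_natural)
  ultimately show ?thesis
    using assms by (simp add: Hom_iff yang_baxter_braid braid_unit_left braid_unit_right)
qed

lemma category_BrAlg: "category (BrAlg M)"
  unfolding BrAlg_def
proof (rule category_structure_cat)
  fix X Y Z f g
  assume "X \<in> Collect (braided_algebra M)" "Y \<in> Collect (braided_algebra M)"
    "Z \<in> Collect (braided_algebra M)" "f \<in> Hom M (fst X) (fst Y)" "g \<in> Hom M (fst Y) (fst Z)"
    "braided_algebra_morphism M X f Y" "braided_algebra_morphism M Y g Z"
  moreover obtain A m u c where X: "X = (A, m, u, c)" by (cases X)
  moreover obtain A' m' u' c' where Y: "Y = (A', m', u', c')" by (cases Y)
  moreover obtain A'' m'' u'' c'' where Z: "Z = (A'', m'', u'', c'')" by (cases Z)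
  ultimately have [simp]: "A \<in> Ob M" "m \<in> Ar M" "Dom M m = A \<otimes> A" "Cod M m = A"
    "u \<in> Ar M" "Dom M u = \<one>" "Cod M u = A" "c \<in> Ar M" "Dom M c = A \<otimes> A" "Cod M c = A \<otimes> A"
    "A' \<in> Ob M" "m' \<in> Ar M" "Dom M m' = A' \<otimes> A'" "Cod M m' = A'"
    "c' \<in> Ar M" "Dom M c' = A' \<otimes> A'" "Cod M c' = A' \<otimes> A'"
    "A'' \<in> Ob M" "m'' \<in> Ar M" "Dom M m'' = A'' \<otimes> A''" "c'' \<in> Ar M" "Dom M c'' = A'' \<otimes> A''"
    "f \<in> Ar M" "Dom M f = A" "Cod M f = A'" "g \<in> Ar M" "Dom M g = A'" "Cod M g = A''"
    and f: "f \<cdot> m = m' \<cdot> (f \<boxtimes> f)" "f \<cdot> u = u'" "c' \<cdot> (f \<boxtimes> f) = (f \<boxtimes> f) \<cdot> c"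
    and g: "g \<cdot> m' = m'' \<cdot> (g \<boxtimes> g)" "g \<cdot> u' = u''" "c'' \<cdot> (g \<boxtimes> g) = (g \<boxtimes> g) \<cdot> c'"
    by (simp_all add: Hom_iff)
  have "(g \<cdot> f) \<cdot> m = m'' \<cdot> (g \<boxtimes> g) \<cdot> (f \<boxtimes> f)"
    using cmp_cmp_eq[OF g(1), of "f \<boxtimes> f"] by (simp add: f)
  moreover have "c'' \<cdot> (g \<boxtimes> g) \<cdot> (f \<boxtimes> f) = (g \<boxtimes> g) \<cdot> (f \<boxtimes> f) \<cdot> c"
    using cmp_cmp_eq[OF g(3), of "f \<boxtimes> f"] by (simp add: f(3))
  ultimately show "braided_algebra_morphism M X (g \<cdot> f) Z"
    by (simp add: X Z f g)
qed (auto simp: Hom_iff)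

end


section \<open>The tensor algebra\<close>

text \<open>Fixes one choice of coproducts for both functors; the two composites can then be equal
  and not merely isomorphic.\<close>

locale tensor_algebra = braided_monoidal_category M
  for M :: "('o, 'm) braided" (structure) +
  fixes S :: "'o \<Rightarrow> 'o" and \<alpha> :: "'o \<Rightarrow> nat \<Rightarrow> 'm"
  assumes preserves: "tensor_preserves_denumerable_coproducts M"
    and coproduct: "V \<in> Ob M \<Longrightarrow> is_coproduct M (tpow M V) (S V) (\<alpha> V)"
begin

lemma
  assumes "V \<in> Ob M"
  shows S_ob [simp]: "S V \<in> Ob M"
    and \<alpha>_ar [simp]: "\<alpha> V n \<in> Ar M"
    and dom_\<alpha> [simp]: "Dom M (\<alpha> V n) = tpow M V n"
    and cod_\<alpha> [simp]: "Cod M (\<alpha> V n) = S V"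
  using coproduct[OF assms] by (simp_all add: is_coproduct_def Hom_iff)

section \<open>Arrows out of tensor products of the coproducts\<close>

lemma
  assumes "is_coproduct M F Y i" "X \<in> Ob M"
  shows tensor_coproduct_left: "is_coproduct M (\<lambda>n. X \<otimes> F n) (X \<otimes> Y) (\<lambda>n. \<iota> X \<boxtimes> i n)"
    and tensor_coproduct_right: "is_coproduct M (\<lambda>n. F n \<otimes> X) (Y \<otimes> X) (\<lambda>n. i n \<boxtimes> \<iota> X)"
  using preserves assms unfolding tensor_preserves_denumerable_coproducts_def by blast+

text \<open>The arrows \<open>\<alpha> V m \<boxtimes> \<alpha> V n\<close> are jointly epic: each
  factors through \<open>\<alpha> V m \<boxtimes> \<iota> (S V)\<close>, so joint epicness can be
  used in one tensor factor at a time.\<close>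

lemma tensor_eqI:
  assumes V [simp]: "V \<in> Ob M"
    and f [simp]: "f \<in> Hom M (S V \<otimes> S V) Y" and g [simp]: "g \<in> Hom M (S V \<otimes> S V) Y"
    and eq: "\<And>m n. f \<cdot> (\<alpha> V m \<boxtimes> \<alpha> V n) = g \<cdot> (\<alpha> V m \<boxtimes> \<alpha> V n)"
  shows "f = g"
proof (rule coproduct_eqI[OF tensor_coproduct_right[OF coproduct] f g])
  fix m
  have [simp]: "f \<in> Ar M" "Dom M f = S V \<otimes> S V" "Cod M f = Y"
    "g \<in> Ar M" "Dom M g = S V \<otimes> S V" "Cod M g = Y"
    using f g by (simp_all only: Hom_iff)
  show "f \<cdot> (\<alpha> V m \<boxtimes> \<iota> (S V)) = g \<cdot> (\<alpha> V m \<boxtimes> \<iota> (S V))"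
  proof (rule coproduct_eqI[OF tensor_coproduct_left[OF coproduct]])
    fix n
    show "(f \<cdot> (\<alpha> V m \<boxtimes> \<iota> (S V))) \<cdot> (\<iota> (tpow M V m) \<boxtimes> \<alpha> V n)
      = (g \<cdot> (\<alpha> V m \<boxtimes> \<iota> (S V))) \<cdot> (\<iota> (tpow M V m) \<boxtimes> \<alpha> V n)"
      by (simp add: eq)
  qed (simp_all add: Hom_iff)
qed simp_all

lemma tensor_ex:
  assumes V [simp]: "V \<in> Ob M" and Y: "Y \<in> Ob M"
    and g: "\<And>m n. g m n \<in> Hom M (tpow M V m \<otimes> tpow M V n) Y"
  obtains h where "h \<in> Hom M (S V \<otimes> S V) Y" "\<And>m n. h \<cdot> (\<alpha> V m \<boxtimes> \<alpha> V n) = g m n"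
proof -
  \<comment> \<open>The family is first glued over \<open>n\<close> with \<open>m\<close> fixed; the
    resulting arrows \<open>k m\<close> are then glued over \<open>m\<close>.\<close>
  have "\<exists>k. k \<in> Hom M (tpow M V m \<otimes> S V) Y \<and> (\<forall>n. k \<cdot> (\<iota> (tpow M V m) \<boxtimes> \<alpha> V n) = g m n)" for m
    by (rule coproduct_ex[OF tensor_coproduct_left[OF coproduct, of V "tpow M V m"] Y, of "g m"])
      (use g in auto)
  then obtain k where k: "\<And>m. k m \<in> Hom M (tpow M V m \<otimes> S V) Y"
    "\<And>m n. k m \<cdot> (\<iota> (tpow M V m) \<boxtimes> \<alpha> V n) = g m n"
    by metis
  obtain h where h: "h \<in> Hom M (S V \<otimes> S V) Y" "\<And>m. h \<cdot> (\<alpha> V m \<boxtimes> \<iota> (S V)) = k m"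
    by (rule coproduct_ex[OF tensor_coproduct_right[OF coproduct, of V "S V"] Y, of k])
      (use k in auto)
  have "h \<cdot> (\<alpha> V m \<boxtimes> \<alpha> V n) = g m n" for m n
  proof -
    have "h \<cdot> (\<alpha> V m \<boxtimes> \<alpha> V n) = (h \<cdot> (\<alpha> V m \<boxtimes> \<iota> (S V))) \<cdot> (\<iota> (tpow M V m) \<boxtimes> \<alpha> V n)"
      using h(1) by (simp add: Hom_iff)
    then show ?thesis using h(2) k(2) by simp
  qed
  with h(1) show ?thesis using that by blast
qed

text \<open>Joint epicness in three factors, needed for associativity of the multiplication.\<close>

lemma tensor_tensor_eqI:
  assumes V [simp]: "V \<in> Ob M"
    and f: "f \<in> Hom M ((S V \<otimes> S V) \<otimes> S V) Y" and g: "g \<in> Hom M ((S V \<otimes> S V) \<otimes> S V) Y"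
    and eq: "\<And>l m n. f \<cdot> ((\<alpha> V l \<boxtimes> \<alpha> V m) \<boxtimes> \<alpha> V n) = g \<cdot> ((\<alpha> V l \<boxtimes> \<alpha> V m) \<boxtimes> \<alpha> V n)"
  shows "f = g"
proof (rule coproduct_eqI[OF tensor_coproduct_right[OF tensor_coproduct_right[OF coproduct]] f g])
  fix l
  let ?L = "tpow M V l"
  have [simp]: "f \<in> Ar M" "Dom M f = (S V \<otimes> S V) \<otimes> S V" "Cod M f = Y"
    "g \<in> Ar M" "Dom M g = (S V \<otimes> S V) \<otimes> S V" "Cod M g = Y"
    using f g by (simp_all only: Hom_iff)
  show "f \<cdot> ((\<alpha> V l \<boxtimes> \<iota> (S V)) \<boxtimes> \<iota> (S V)) = g \<cdot> ((\<alpha> V l \<boxtimes> \<iota> (S V)) \<boxtimes> \<iota> (S V))"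
  proof (rule coproduct_eqI[OF tensor_coproduct_right[OF tensor_coproduct_left[OF coproduct]]])
    fix m
    show "(f \<cdot> ((\<alpha> V l \<boxtimes> \<iota> (S V)) \<boxtimes> \<iota> (S V))) \<cdot> ((\<iota> ?L \<boxtimes> \<alpha> V m) \<boxtimes> \<iota> (S V))
      = (g \<cdot> ((\<alpha> V l \<boxtimes> \<iota> (S V)) \<boxtimes> \<iota> (S V))) \<cdot> ((\<iota> ?L \<boxtimes> \<alpha> V m) \<boxtimes> \<iota> (S V))"
    proof (rule coproduct_eqI[OF tensor_coproduct_left[OF coproduct]])
      fix n
      show "((f \<cdot> ((\<alpha> V l \<boxtimes> \<iota> (S V)) \<boxtimes> \<iota> (S V))) \<cdot> ((\<iota> ?L \<boxtimes> \<alpha> V m) \<boxtimes> \<iota> (S V)))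
          \<cdot> (\<iota> (?L \<otimes> tpow M V m) \<boxtimes> \<alpha> V n)
        = ((g \<cdot> ((\<alpha> V l \<boxtimes> \<iota> (S V)) \<boxtimes> \<iota> (S V))) \<cdot> ((\<iota> ?L \<boxtimes> \<alpha> V m) \<boxtimes> \<iota> (S V)))
          \<cdot> (\<iota> (?L \<otimes> tpow M V m) \<boxtimes> \<alpha> V n)"
        by (simp add: eq)
    qed (simp_all add: Hom_iff)
  qed (simp_all add: Hom_iff)
qed simp_all

section \<open>The algebra structure of the tensor algebra\<close>

lemma T_mult:
  assumes [simp]: "V \<in> Ob M"
  shows "T_mult M S \<alpha> V \<in> Hom M (S V \<otimes> S V) (S V) \<and>
    (\<forall>m n. T_mult M S \<alpha> V \<cdot> (\<alpha> V m \<boxtimes> \<alpha> V n) = \<alpha> V (m + n) \<cdot> tmerge M V m n)"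
  unfolding T_mult_def
proof (rule theI')
  obtain \<mu> where "\<mu> \<in> Hom M (S V \<otimes> S V) (S V)"
    "\<And>m n. \<mu> \<cdot> (\<alpha> V m \<boxtimes> \<alpha> V n) = \<alpha> V (m + n) \<cdot> tmerge M V m n"
    by (rule tensor_ex[of V "S V" "\<lambda>m n. \<alpha> V (m + n) \<cdot> tmerge M V m n"]) (auto simp: Hom_iff)
  then show "\<exists>!\<mu>. \<mu> \<in> Hom M (S V \<otimes> S V) (S V) \<and>
    (\<forall>m n. \<mu> \<cdot> (\<alpha> V m \<boxtimes> \<alpha> V n) = \<alpha> V (m + n) \<cdot> tmerge M V m n)"
    by (metis tensor_eqI[OF assms])
qed

lemma
  assumes "V \<in> Ob M"
  shows T_mult_ar [simp]: "T_mult M S \<alpha> V \<in> Ar M"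
    and dom_T_mult [simp]: "Dom M (T_mult M S \<alpha> V) = S V \<otimes> S V"
    and cod_T_mult [simp]: "Cod M (T_mult M S \<alpha> V) = S V"
    and T_mult_\<alpha> [simp]: "T_mult M S \<alpha> V \<cdot> (\<alpha> V m \<boxtimes> \<alpha> V n) = \<alpha> V (m + n) \<cdot> tmerge M V m n"
  using T_mult[OF assms] by (simp_all add: Hom_iff)

lemma T_mult_\<alpha>_cmp [simp]:
  assumes "V \<in> Ob M" "k \<in> Ar M" "Cod M k = tpow M V m \<otimes> tpow M V n"
  shows "T_mult M S \<alpha> V \<cdot> (\<alpha> V m \<boxtimes> \<alpha> V n) \<cdot> k = \<alpha> V (m + n) \<cdot> tmerge M V m n \<cdot> k"
  by (rule cmp_cmp_eq[OF T_mult_\<alpha>]) (use assms in simp_all)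

text \<open>On the components \<open>l\<close>, \<open>m\<close>, \<open>n\<close> both sides reduce
  to merging of tensor powers, where \<open>tmerge_assoc\<close> applies.\<close>

lemma T_mult_assoc:
  assumes [simp]: "V \<in> Ob M"
  shows "T_mult M S \<alpha> V \<cdot> (T_mult M S \<alpha> V \<boxtimes> \<iota> (S V))
    = T_mult M S \<alpha> V \<cdot> (\<iota> (S V) \<boxtimes> T_mult M S \<alpha> V) \<cdot> \<a> (S V) (S V) (S V)"
proof (rule tensor_tensor_eqI)
  fix l m n :: nat
  let ?\<mu> = "T_mult M S \<alpha> V" and ?L = "tpow M V l" and ?M = "tpow M V m" and ?N = "tpow M V n"
  have "(?\<mu> \<cdot> (?\<mu> \<boxtimes> \<iota> (S V))) \<cdot> ((\<alpha> V l \<boxtimes> \<alpha> V m) \<boxtimes> \<alpha> V n)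
    = ?\<mu> \<cdot> (\<alpha> V (l + m) \<boxtimes> \<alpha> V n) \<cdot> (tmerge M V l m \<boxtimes> \<iota> ?N)"
    \<comment> \<open>The outer multiplication must stay unevaluated here, so that the interchange
      law brings both sides to the same form.\<close>
    by (simp del: T_mult_\<alpha>_cmp)
  also have "\<dots> = \<alpha> V (l + m + n) \<cdot> tmerge M V (l + m) n \<cdot> (tmerge M V l m \<boxtimes> \<iota> ?N)"
    by (subst T_mult_\<alpha>_cmp) simp_all
  also have "\<dots> = \<alpha> V (l + m + n) \<cdot> tmerge M V l (m + n) \<cdot> (\<iota> ?L \<boxtimes> tmerge M V m n) \<cdot> \<a> ?L ?M ?N"
    by (simp add: tmerge_assoc)
  also have "\<dots> = ?\<mu> \<cdot> (\<alpha> V l \<boxtimes> \<alpha> V (m + n)) \<cdot> (\<iota> ?L \<boxtimes> tmerge M V m n) \<cdot> \<a> ?L ?M ?N"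
    by (subst T_mult_\<alpha>_cmp) (simp_all add: add.assoc)
  also have "\<dots> = ?\<mu> \<cdot> (\<iota> (S V) \<boxtimes> ?\<mu>) \<cdot> (\<alpha> V l \<boxtimes> (\<alpha> V m \<boxtimes> \<alpha> V n)) \<cdot> \<a> ?L ?M ?N"
    by (simp del: T_mult_\<alpha>_cmp)
  also have "\<dots> = ?\<mu> \<cdot> (\<iota> (S V) \<boxtimes> ?\<mu>) \<cdot> \<a> (S V) (S V) (S V) \<cdot> ((\<alpha> V l \<boxtimes> \<alpha> V m) \<boxtimes> \<alpha> V n)"
    by (subst assoc_natural) simp_all
  also have "\<dots> = (?\<mu> \<cdot> (\<iota> (S V) \<boxtimes> ?\<mu>) \<cdot> \<a> (S V) (S V) (S V)) \<cdot> ((\<alpha> V l \<boxtimes> \<alpha> V m) \<boxtimes> \<alpha> V n)"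
    by simp
  finally show "(?\<mu> \<cdot> (?\<mu> \<boxtimes> \<iota> (S V))) \<cdot> ((\<alpha> V l \<boxtimes> \<alpha> V m) \<boxtimes> \<alpha> V n)
    = (?\<mu> \<cdot> (\<iota> (S V) \<boxtimes> ?\<mu>) \<cdot> \<a> (S V) (S V) (S V)) \<cdot> ((\<alpha> V l \<boxtimes> \<alpha> V m) \<boxtimes> \<alpha> V n)" .
qed (simp_all add: Hom_iff)

text \<open>On the component \<open>n\<close> the product is
  \<open>\<alpha> V n \<cdot> \<l> (tpow V n)\<close> by \<open>tmerge_0_left\<close>, and
  naturality of \<open>\<l>\<close> along \<open>\<alpha> V n\<close> gives the claim.\<close>

lemma T_mult_unit_left:
  assumes [simp]: "V \<in> Ob M"
  shows "T_mult M S \<alpha> V \<cdot> (\<alpha> V 0 \<boxtimes> \<iota> (S V)) = \<l> (S V)"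
proof (rule coproduct_eqI[OF tensor_coproduct_left[OF coproduct, of V "\<one>"]])
  fix n
  show "(T_mult M S \<alpha> V \<cdot> (\<alpha> V 0 \<boxtimes> \<iota> (S V))) \<cdot> (\<iota> \<one> \<boxtimes> \<alpha> V n) = \<l> (S V) \<cdot> (\<iota> \<one> \<boxtimes> \<alpha> V n)"
    by (simp add: tmerge_0_left lunit_natural)
qed (simp_all add: Hom_iff)

lemma T_mult_unit_right:
  assumes [simp]: "V \<in> Ob M"
  shows "T_mult M S \<alpha> V \<cdot> (\<iota> (S V) \<boxtimes> \<alpha> V 0) = \<r> (S V)"
proof (rule coproduct_eqI[OF tensor_coproduct_right[OF coproduct, of V "\<one>"]])
  fix n
  show "(T_mult M S \<alpha> V \<cdot> (\<iota> (S V) \<boxtimes> \<alpha> V 0)) \<cdot> (\<alpha> V n \<boxtimes> \<iota> \<one>) = \<r> (S V) \<cdot> (\<alpha> V n \<boxtimes> \<iota> \<one>)"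
    by (simp add: runit_natural)
qed (simp_all add: Hom_iff)

lemma algebra_T_ob: "V \<in> Ob M \<Longrightarrow> algebra M (T_ob M S \<alpha> V)"
  by (simp add: T_ob_def Hom_iff T_mult_assoc T_mult_unit_left T_mult_unit_right)

section \<open>The tensor algebra on arrows\<close>

lemma T_ar:
  assumes [simp]: "f \<in> Ar M"
  shows "T_ar M S \<alpha> f \<in> Hom M (S (Dom M f)) (S (Cod M f)) \<and>
    (\<forall>n. T_ar M S \<alpha> f \<cdot> \<alpha> (Dom M f) n = \<alpha> (Cod M f) n \<cdot> tpow_ar M f n)"
  unfolding T_ar_def
proof (rule theI')
  obtain g where "g \<in> Hom M (S (Dom M f)) (S (Cod M f))"
    "\<And>n. g \<cdot> \<alpha> (Dom M f) n = \<alpha> (Cod M f) n \<cdot> tpow_ar M f n"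
    by (rule coproduct_ex[OF coproduct, of "Dom M f" "S (Cod M f)" "\<lambda>n. \<alpha> (Cod M f) n \<cdot> tpow_ar M f n"])
      (auto simp: Hom_iff)
  then show "\<exists>!g. g \<in> Hom M (S (Dom M f)) (S (Cod M f)) \<and>
    (\<forall>n. g \<cdot> \<alpha> (Dom M f) n = \<alpha> (Cod M f) n \<cdot> tpow_ar M f n)"
    by (metis coproduct_eqI[OF coproduct[OF dom_ob[OF assms]]])
qed

lemma
  assumes "f \<in> Ar M"
  shows T_ar_ar [simp]: "T_ar M S \<alpha> f \<in> Ar M"
    and dom_T_ar [simp]: "Dom M (T_ar M S \<alpha> f) = S (Dom M f)"
    and cod_T_ar [simp]: "Cod M (T_ar M S \<alpha> f) = S (Cod M f)"
    and T_ar_\<alpha>: "X = Dom M f \<Longrightarrow> T_ar M S \<alpha> f \<cdot> \<alpha> X n = \<alpha> (Cod M f) n \<cdot> tpow_ar M f n"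
  using T_ar[OF assms] by (simp_all add: Hom_iff)

lemma T_ar_\<alpha>_cmp:
  assumes "f \<in> Ar M" "X = Dom M f" "k \<in> Ar M" "Cod M k = tpow M X n"
  shows "T_ar M S \<alpha> f \<cdot> \<alpha> X n \<cdot> k = \<alpha> (Cod M f) n \<cdot> tpow_ar M f n \<cdot> k"
  by (rule cmp_cmp_eq[OF T_ar_\<alpha>]) (use assms in simp_all)

lemma T_ar_ident:
  assumes "V \<in> Ob M"
  shows "T_ar M S \<alpha> (\<iota> V) = \<iota> (S V)"
  by (rule coproduct_eqI[OF coproduct[OF assms]]) (use assms in \<open>simp_all add: Hom_iff T_ar_\<alpha> tpow_ar_ident\<close>)

lemma T_ar_cmp:
  assumes "f \<in> Ar M" "g \<in> Ar M" "Dom M g = Cod M f"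
  shows "T_ar M S \<alpha> (g \<cdot> f) = T_ar M S \<alpha> g \<cdot> T_ar M S \<alpha> f"
  by (rule coproduct_eqI[OF coproduct, of "Dom M f"])
    (use assms in \<open>simp_all add: Hom_iff T_ar_\<alpha> T_ar_\<alpha>_cmp tpow_ar_cmp\<close>)

text \<open>Tested on \<open>\<alpha> V m \<boxtimes> \<alpha> V n\<close> with
  \<open>V = Dom M f\<close>, the claim becomes \<open>tmerge_natural\<close>.\<close>

lemma T_ar_T_mult:
  assumes [simp]: "f \<in> Ar M"
  shows "T_ar M S \<alpha> f \<cdot> T_mult M S \<alpha> (Dom M f)
    = T_mult M S \<alpha> (Cod M f) \<cdot> (T_ar M S \<alpha> f \<boxtimes> T_ar M S \<alpha> f)"
proof (rule tensor_eqI)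
  fix m n
  let ?X = "Dom M f" and ?Y = "Cod M f" and ?T = "T_ar M S \<alpha> f"
  have "(?T \<cdot> T_mult M S \<alpha> ?X) \<cdot> (\<alpha> ?X m \<boxtimes> \<alpha> ?X n)
      = \<alpha> ?Y (m + n) \<cdot> tmerge M ?Y m n \<cdot> (tpow_ar M f m \<boxtimes> tpow_ar M f n)"
    by (simp add: T_ar_\<alpha>_cmp tmerge_natural)
  also have "\<dots> = T_mult M S \<alpha> ?Y \<cdot> (\<alpha> ?Y m \<boxtimes> \<alpha> ?Y n) \<cdot> (tpow_ar M f m \<boxtimes> tpow_ar M f n)"
    by (subst T_mult_\<alpha>_cmp) simp_all
  also have "\<dots> = T_mult M S \<alpha> ?Y \<cdot> ((?T \<cdot> \<alpha> ?X m) \<boxtimes> (?T \<cdot> \<alpha> ?X n))"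
    by (simp add: T_ar_\<alpha> del: T_mult_\<alpha>_cmp)
  also have "\<dots> = (T_mult M S \<alpha> ?Y \<cdot> (?T \<boxtimes> ?T)) \<cdot> (\<alpha> ?X m \<boxtimes> \<alpha> ?X n)"
    by simp
  finally show "(?T \<cdot> T_mult M S \<alpha> ?X) \<cdot> (\<alpha> ?X m \<boxtimes> \<alpha> ?X n)
      = (T_mult M S \<alpha> ?Y \<cdot> (?T \<boxtimes> ?T)) \<cdot> (\<alpha> ?X m \<boxtimes> \<alpha> ?X n)" .
qed (simp_all add: Hom_iff)

lemma algebra_morphism_T_ar:
  "f \<in> Ar M \<Longrightarrow> algebra_morphism M (T_ob M S \<alpha> (Dom M f)) (T_ar M S \<alpha> f) (T_ob M S \<alpha> (Cod M f))"
  by (simp add: T_ob_def T_ar_T_mult T_ar_\<alpha>)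

section \<open>The braiding of the tensor algebra and the two composites\<close>

lemma T_braiding_braid:
  assumes [simp]: "V \<in> Ob M"
  shows "T_braiding M S \<alpha> V (\<c> V V) = \<c> (S V) (S V)"
  unfolding T_braiding_def
proof (rule the_equality)
  show "\<c> (S V) (S V) \<in> Hom M (S V \<otimes> S V) (S V \<otimes> S V) \<and>
    (\<forall>m n. \<c> (S V) (S V) \<cdot> (\<alpha> V m \<boxtimes> \<alpha> V n)
      = (\<alpha> V n \<boxtimes> \<alpha> V m) \<cdot> tpow_braiding M V (\<c> V V) m n)"
    \<comment> \<open>Once \<open>tpow_braiding\<close> is known to be the braiding of the tensor
      powers, the defining equation is naturality along the injections.\<close>
    by (simp add: Hom_iff braid_natural tpow_braiding_braid)
  then show "c = \<c> (S V) (S V)" if "c \<in> Hom M (S V \<otimes> S V) (S V \<otimes> S V) \<and>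
    (\<forall>m n. c \<cdot> (\<alpha> V m \<boxtimes> \<alpha> V n) = (\<alpha> V n \<boxtimes> \<alpha> V m) \<cdot> tpow_braiding M V (\<c> V V) m n)" for c
    using that by (metis tensor_eqI[OF assms])
qed

definition braided_T ::
    "('o, 'm, 'o \<times> 'm \<times> 'm \<times> 'm, ('o \<times> 'm \<times> 'm \<times> 'm) \<times> 'm \<times> ('o \<times> 'm \<times> 'm \<times> 'm)) cat_map"
  where "braided_T =
    \<lparr>OnOb = (\<lambda>V \<in> Ob M. with_braiding M (T_ob M S \<alpha> V)),
     OnAr = (\<lambda>f \<in> Ar M. (with_braiding M (T_ob M S \<alpha> (Dom M f)), T_ar M S \<alpha> f,
       with_braiding M (T_ob M S \<alpha> (Cod M f))))\<rparr>"

lemma fst_T_ob [simp]: "fst (T_ob M S \<alpha> V) = S V"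
  by (simp add: T_ob_def)

text \<open>\<open>J\<^sub>A\<^sub>l\<^sub>g\<close> is undefined off \<open>Alg\<close>, so the
  values of \<open>T\<close> must be shown to be algebras and algebra morphisms.\<close>

lemma J_Alg_comp_T: "J\<^sub>A\<^sub>l\<^sub>g M \<circ>\<^bsub>M\<^esub> T M S \<alpha> = braided_T"
  by (auto simp: cat_map_comp_def braided_T_def J\<^sub>A\<^sub>l\<^sub>g_def T_def Alg_def structure_cat_def compose_def
      algebra_T_ob algebra_morphism_T_ar Hom_iff intro!: restrict_ext)

text \<open>The Yang-Baxter equation and naturality place the values of \<open>J\<close> in
  \<open>Br\<close>; \<open>T_braiding_braid\<close> then identifies the braidings.\<close>

lemma T_Br_comp_J: "T\<^sub>B\<^sub>r M S \<alpha> \<circ>\<^bsub>M\<^esub> J M = braided_T"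
  by (auto simp: cat_map_comp_def braided_T_def T\<^sub>B\<^sub>r_def J_def Br_def structure_cat_def compose_def
      Hom_iff yang_baxter_braid braid_natural T_braiding_braid T_ob_def intro!: restrict_ext)

lemma braided_T_functor: "cat_functor M (BrAlg M) braided_T"
proof (intro cat_functor.intro cat_functor_axioms.intro)
  have alg: "braided_algebra M (with_braiding M (T_ob M S \<alpha> V))" if "V \<in> Ob M" for V
    using algebra_T_ob[OF that] braided_algebra_braid by (cases "T_ob M S \<alpha> V") auto
  have mor: "braided_algebra_morphism M (with_braiding M (T_ob M S \<alpha> (Dom M f))) (T_ar M S \<alpha> f)
      (with_braiding M (T_ob M S \<alpha> (Cod M f)))" if "f \<in> Ar M" for f
    \<comment> \<open>Compatibility with the braidings is naturality of \<open>\<c>\<close> at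
      \<open>T_ar f\<close>.\<close>
    using algebra_morphism_T_ar[OF that] that by (simp add: T_ob_def braid_natural)
  have [simp]: "fst (with_braiding M (T_ob M S \<alpha> V)) = S V" for V
    by (simp add: T_ob_def)
  show "category M" by unfold_locales
  show "category (BrAlg M)" by (rule category_BrAlg)
  show "OnOb braided_T \<in> Ob M \<rightarrow>\<^sub>E Ob (BrAlg M)"
    by (auto simp: braided_T_def BrAlg_def structure_cat_def alg simp del: braided_algebra.simps)
  show "OnAr braided_T \<in> Ar M \<rightarrow>\<^sub>E Ar (BrAlg M)"
    by (auto simp: braided_T_def BrAlg_def structure_cat_def alg mor Hom_iff
        simp del: braided_algebra.simps braided_algebra_morphism.simps)
  show "OnAr braided_T f \<in> Hom (BrAlg M) (OnOb braided_T X) (OnOb braided_T Y)"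
    if "f \<in> Hom M X Y" for f X Y
    using that by (auto simp: braided_T_def BrAlg_def structure_cat_def alg mor Hom_iff
        simp del: braided_algebra.simps braided_algebra_morphism.simps)
  show "OnAr braided_T (\<iota> X) = \<iota>\<^bsub>BrAlg M\<^esub> (OnOb braided_T X)" if "X \<in> Ob M" for X
    using that by (simp add: braided_T_def BrAlg_def structure_cat_def T_ar_ident)
  show "OnAr braided_T (g \<cdot> f) = OnAr braided_T g \<cdot>\<^bsub>BrAlg M\<^esub> OnAr braided_T f"
    if "f \<in> Hom M X Y" "g \<in> Hom M Y Z" for f g X Y Z
    using that by (simp add: braided_T_def BrAlg_def structure_cat_def T_ar_cmp Hom_iff)
qed

end

theorem proposition4p5:
  fixes M :: "('o, 'm) braided"
    and S :: "'o \<Rightarrow> 'o"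
    and \<alpha> :: "'o \<Rightarrow> nat \<Rightarrow> 'm"
  assumes "braided_monoidal_category M"
    and "has_denumerable_coproducts M"
    and "tensor_preserves_denumerable_coproducts M"
    and "\<And>V. V \<in> Ob M \<Longrightarrow> is_coproduct M (tpow M V) (S V) (\<alpha> V)"
  shows "cat_functor M (BrAlg M) (J\<^sub>A\<^sub>l\<^sub>g M \<circ>\<^bsub>M\<^esub> T M S \<alpha>) \<and>
    J\<^sub>A\<^sub>l\<^sub>g M \<circ>\<^bsub>M\<^esub> T M S \<alpha> = T\<^sub>B\<^sub>r M S \<alpha> \<circ>\<^bsub>M\<^esub> J M"
proof -
  interpret tensor_algebra M S \<alpha>
    using assms by (intro tensor_algebra.intro tensor_algebra_axioms.intro)
  show ?thesis
    by (simp add: J_Alg_comp_T T_Br_comp_J braided_T_functor)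
qed

end
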